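(* Let $D,E$ satisfy $D^2\neq 4$, $1+2ED+4E^2\neq 0$ and $D+2E\neq 0$, and let $R$ be a square root of $1+2DE+4E^2$. Let $B_0,B_1,B_2,\dots$ be the coefficients of the Taylor expansion around $\xi=0$, $\sum_{k\ge 0}B_k\xi^k$, of $$\sqrt{\left(2(D+2E)\xi-R\right)\left(4R(D+2E)^2\xi^2+2(D+2E)(D^2+2DE-2)\xi+R\right)}$$ (for a fixed choice of branch of the square root near $\xi=0$). Then the trajectories of the Boltzmann system with integrals $D$ and $E$ are $n$-periodic if and only if $$\det\begin{pmatrix} B_3&B_4&\cdots&B_{m+1}\\ B_4&B_5&\cdots&B_{m+2}\\ \vdots&\vdots&&\vdots\\ B_{m+1}&B_{m+2}&\cdots&B_{2m-1}\end{pmatrix}=0\quad\text{when } n=2m\ge 4,$$ respectively $$\det\begin{pmatrix} B_2&B_3&\cdots&B_{m+1}\\ B_3&B_4&\cdots&B_{m+2}\\ \vdots&\vdots&&\vdots\\ B_{m+1}&B_{m+2}&\cdots&B_{2m}\end{pmatrix}=0\quad\text{when } n=2m+1\ge 3.$$ (The first matrix is the $(m-1)\times(m-1)$ Hankel matrix with $(p,q)$ entry $B_{p+q+1}$; the second is the $m\times m$ Hankel matrix with $(p,q)$ entry $B_{p+q}$.)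
   Context: The Boltzmann system: a unit-mass particle moves in the plane with coordinates $(x_1,x_2)$ under the Kepler potential $-1/|\mathbf r|$ with centre of gravity at the origin, on the side $x_2\ge 1$ of the wall $x_2=1$, and is reflected elastically at the wall (speed preserved, angle of incidence equals angle of reflection). Let $E=|\mathbf p|^2/2-1/|\mathbf r|$ be the energy, $L$ the angular momentum, and $\mathbf A=(A_1,A_2)=\mathbf p\times\mathbf L-\mathbf r/|\mathbf r|$ the Laplace–Runge–Lenz vector. Both $E$ and $D:=L^2-2A_2$ are preserved by the motion and the reflections. A state at the wall is described by $(x,A_1,A_2)$, where $(x,1)$ is the reflection point and $(A_1,A_2)$ is the Laplace–Runge–Lenz vector of the Kepler arc. For fixed $D,E$ the level set $X(D,E)$ is the (complex) affine curve $$A_1^2+A_2^2-4EA_2=1+2DE,\qquad x^2+1=(A_2+D-A_1x)^2,$$ which under the conditions $D^2\ne4$, $1+2ED+4E^2\ne0$, $D+2E\ne0$ has as compactification a smooth projective curve of genus $1$. The Boltzmann map is $j\circ i$, where $i,j$ are the involutions $$i(x,A_1,A_2)=(x',A_1,A_2),\qquad j(x,A_1,A_2)=(x,A_1',A_2'),$$ $$x'=\frac{-2(A_2+D)A_1}{1-A_1^2}-x,\quad A_1'=\frac{(x^2-1)A_1-2xA_2+4xE}{x^2+1},\quad A_2'=\frac{-2xA_1-(x^2-1)A_2+4x^2E}{x^2+1},$$ extended to automorphisms of the compactified level curve. ($i$ exchanges the two intersection points of the Kepler conic with the wall; $j$ is the reflection off the wall.) A trajectory with integrals $D,E$ is an orbit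 of the Boltzmann map on this curve. It is called $n$-periodic if the $n$-th iterate of the Boltzmann map returns each of its points to itself ($n$ need not be the minimal period). *)

theory Defs
  imports "HOL-Analysis.FPS_Convergence" "Jordan_Normal_Form.Determinant"
begin

section \<open>The affine level curve and the two involutions\<close>

definition level_curve :: "complex \<Rightarrow> complex \<Rightarrow> (complex \<times> complex \<times> complex) set" where
  "level_curve D E = {(x, A1, A2).
     A1^2 + A2^2 - 4 * E * A2 = 1 + 2 * D * E \<and> x^2 + 1 = (A2 + D - A1 * x)^2}"

fun wall_exchange ::
  "complex \<Rightarrow> complex \<times> complex \<times> complex \<Rightarrow> complex \<times> complex \<times> complex" where
  "wall_exchange D (x, A1, A2) = (- 2 * (A2 + D) * A1 / (1 - A1^2) - x, A1, A2)"

fun wall_reflection ::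
  "complex \<Rightarrow> complex \<times> complex \<times> complex \<Rightarrow> complex \<times> complex \<times> complex" where
  "wall_reflection E (x, A1, A2) =
     (x,
      ((x^2 - 1) * A1 - 2 * x * A2 + 4 * x * E) / (x^2 + 1),
      (- 2 * x * A1 - (x^2 - 1) * A2 + 4 * x^2 * E) / (x^2 + 1))"

section \<open>The compactified level curve\<close>

text \<open>The point of the projective plane with the given homogeneous coordinates, as the set of all
  its coordinate vectors; meaningful for vectors other than \<^term>\<open>0\<close>.\<close>

fun hpt :: "complex \<times> complex \<times> complex \<Rightarrow> (complex \<times> complex \<times> complex) set" where
  "hpt (a, b, c) = {(k * a, k * b, k * c) | k. k \<noteq> 0}"

type_synonym hvec2 = "(complex \<times> complex \<times> complex) \<times> (complex \<times> complex \<times> complex)"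
type_synonym ppt2 =
  "(complex \<times> complex \<times> complex) set \<times> (complex \<times> complex \<times> complex) set"

fun hpt2 :: "hvec2 \<Rightarrow> ppt2" where
  "hpt2 (u, a) = (hpt u, hpt a)"

text \<open>Introduce on the level curve the function \<open>s = A2 + D - A1 x\<close>. It is then given by the
  equations \<open>x^2 + 1 = s^2\<close>, \<open>A1^2 + A2^2 - 4 E A2 = 1 + 2 D E\<close> and \<open>s = A2 + D - A1 x\<close>. The
  compactification is obtained by homogenizing these in \<open>(x : s : w)\<close> and \<open>(A1 : A2 : A0)\<close>; it lies
  in the product of two projective planes. If \<open>D^2 \<noteq> 4\<close>, \<open>1 + 2 E D + 4 E^2 \<noteq> 0\<close> and
  \<open>D + 2 E \<noteq> 0\<close>, the Jacobian criterion shows that this curve is smooth. The affine curve is the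
  part \<open>w \<noteq> 0\<close>, \<open>A0 \<noteq> 0\<close>, and only finitely many points have \<open>w = 0\<close> (i.e. \<open>x = \<infinity>\<close>) or
  \<open>A0 = 0\<close> (i.e. \<open>A = \<infinity>\<close>).\<close>

fun on_cone :: "complex \<Rightarrow> complex \<Rightarrow> hvec2 \<Rightarrow> bool" where
  "on_cone D E ((x, s, w), (A1, A2, A0)) \<longleftrightarrow>
     (x, s, w) \<noteq> 0 \<and> (A1, A2, A0) \<noteq> 0 \<and>
     x^2 + w^2 = s^2 \<and>
     A1^2 + A2^2 - 4 * E * A2 * A0 = (1 + 2 * D * E) * A0^2 \<and>
     s * A0 = A2 * w + D * w * A0 - A1 * x"

definition compact_curve :: "complex \<Rightarrow> complex \<Rightarrow> ppt2 set" where
  "compact_curve D E = hpt2 ` {z. on_cone D E z}"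

fun embed :: "complex \<Rightarrow> complex \<times> complex \<times> complex \<Rightarrow> ppt2" where
  "embed D (x, A1, A2) = hpt2 ((x, A2 + D - A1 * x, 1), (A1, A2, 1))"

section \<open>Automorphisms\<close>

inductive polynomial_fn :: "(hvec2 \<Rightarrow> complex) \<Rightarrow> bool" where
  const: "polynomial_fn (\<lambda>z. c)"
| fst1: "polynomial_fn (\<lambda>z. fst (fst z))"
| fst2: "polynomial_fn (\<lambda>z. fst (snd (fst z)))"
| fst3: "polynomial_fn (\<lambda>z. snd (snd (fst z)))"
| snd1: "polynomial_fn (\<lambda>z. fst (snd z))"
| snd2: "polynomial_fn (\<lambda>z. fst (snd (snd z)))"
| snd3: "polynomial_fn (\<lambda>z. snd (snd (snd z)))"
| add: "polynomial_fn f \<Longrightarrow> polynomial_fn g \<Longrightarrow> polynomial_fn (\<lambda>z. f z + g z)"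
| mult: "polynomial_fn f \<Longrightarrow> polynomial_fn g \<Longrightarrow> polynomial_fn (\<lambda>z. f z * g z)"

definition polynomial_triple :: "(hvec2 \<Rightarrow> complex \<times> complex \<times> complex) \<Rightarrow> bool" where
  "polynomial_triple P \<longleftrightarrow> polynomial_fn (\<lambda>z. fst (P z)) \<and>
     polynomial_fn (\<lambda>z. fst (snd (P z))) \<and> polynomial_fn (\<lambda>z. snd (snd (P z)))"

text \<open>A map of the curve to itself is a morphism if around every point it is given by polynomials
  in the coordinates, on the Zariski neighbourhood where these define a point. The polynomials need
  not be assumed homogeneous: the equation is required for all coordinate vectors of a point.\<close>

definition regular_map :: "complex \<Rightarrow> complex \<Rightarrow> (ppt2 \<Rightarrow> ppt2) \<Rightarrow> bool" where
  "regular_map D E F \<longleftrightarrow> F \<in> compact_curve D E \<rightarrow> compact_curve D E \<and>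
     (\<forall>z. on_cone D E z \<longrightarrow>
        (\<exists>P Q. polynomial_triple P \<and> polynomial_triple Q \<and> P z \<noteq> 0 \<and> Q z \<noteq> 0 \<and>
           (\<forall>z'. on_cone D E z' \<and> P z' \<noteq> 0 \<and> Q z' \<noteq> 0 \<longrightarrow>
              F (hpt2 z') = hpt2 (P z', Q z'))))"

definition curve_automorphism :: "complex \<Rightarrow> complex \<Rightarrow> (ppt2 \<Rightarrow> ppt2) \<Rightarrow> bool" where
  "curve_automorphism D E F \<longleftrightarrow>
     bij_betw F (compact_curve D E) (compact_curve D E) \<and>
     regular_map D E F \<and> regular_map D E (inv_into (compact_curve D E) F)"

text \<open>The extensions of the two involutions to the compactified curve. The formula for
  \<^const>\<open>wall_exchange\<close> is used where its denominator \<open>1 - A1^2\<close> does not vanish, the one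
  for \<^const>\<open>wall_reflection\<close> where \<open>x^2 + 1\<close> does not vanish; both conditions exclude
  only finitely many points, so that the extensions are unique on the curve. Their existence
  is shown below.\<close>

definition extends_wall_exchange :: "complex \<Rightarrow> complex \<Rightarrow> (ppt2 \<Rightarrow> ppt2) \<Rightarrow> bool" where
  "extends_wall_exchange D E I \<longleftrightarrow> curve_automorphism D E I \<and>
     (\<forall>x A1 A2. (x, A1, A2) \<in> level_curve D E \<and> 1 - A1^2 \<noteq> 0 \<longrightarrow>
        I (embed D (x, A1, A2)) = embed D (wall_exchange D (x, A1, A2)))"

definition extends_wall_reflection :: "complex \<Rightarrow> complex \<Rightarrow> (ppt2 \<Rightarrow> ppt2) \<Rightarrow> bool" where
  "extends_wall_reflection D E J \<longleftrightarrow> curve_automorphism D E J \<and>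
     (\<forall>x A1 A2. (x, A1, A2) \<in> level_curve D E \<and> x^2 + 1 \<noteq> 0 \<longrightarrow>
        J (embed D (x, A1, A2)) = embed D (wall_reflection E (x, A1, A2)))"

section \<open>Periodic trajectories\<close>

definition trajectories :: "complex \<Rightarrow> complex \<Rightarrow> (ppt2 \<Rightarrow> ppt2) \<Rightarrow> ppt2 set set" where
  "trajectories D E T = {{(T ^^ k) p | k. True} | p. p \<in> compact_curve D E}"

definition periodic_trajectory :: "(ppt2 \<Rightarrow> ppt2) \<Rightarrow> nat \<Rightarrow> ppt2 set \<Rightarrow> bool" where
  "periodic_trajectory T n S \<longleftrightarrow> (\<forall>q\<in>S. (T ^^ n) q = q)"

section \<open>Existence of the extensions\<close>

lemma hpt_scale: "k \<noteq> 0 \<Longrightarrow> hpt (k * a, k * b, k * c) = hpt (a, b, c)"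
proof -
  assume k: "k \<noteq> 0"
  have "\<exists>l'. (l * (k * a), l * (k * b), l * (k * c)) = (l' * a, l' * b, l' * c) \<and> l' \<noteq> 0"
    if "l \<noteq> 0" for l
    using k that by (intro exI[of _ "l * k"]) auto
  moreover have "\<exists>l'. (l * a, l * b, l * c) = (l' * (k * a), l' * (k * b), l' * (k * c)) \<and> l' \<noteq> 0"
    if "l \<noteq> 0" for l
    using k that by (intro exI[of _ "l / k"]) auto
  ultimately show ?thesis by (auto; blast)
qed

lemma hpt_eqD:
  assumes "hpt (a, b, c) = hpt (a', b', c')"
  obtains k where "k \<noteq> 0" "a' = k * a" "b' = k * b" "c' = k * c"
proof -
  have "(a', b', c') \<in> hpt (a', b', c')"
    by (auto intro!: exI[of _ "1 :: complex"])
  with assms have "(a', b', c') \<in> hpt (a, b, c)" by simp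
  then show ?thesis using that by auto
qed

lemma hpt_eqI:
  assumes "(a, b, c) \<noteq> 0" "(a', b', c') \<noteq> 0"
    and "a * b' = b * a'" "a * c' = c * a'" "b * c' = c * b'"
  shows "hpt (a, b, c) = hpt (a', b', c')"
proof -
  consider "a \<noteq> 0" | "a = 0" "b \<noteq> 0" | "a = 0" "b = 0" "c \<noteq> 0"
    using assms(1) by (auto simp: zero_prod_def)
  then have "\<exists>k. k \<noteq> 0 \<and> a' = k * a \<and> b' = k * b \<and> c' = k * c"
  proof cases
    case 1
    with assms have "a' \<noteq> 0" by (auto simp: zero_prod_def)
    with 1 assms show ?thesis by (intro exI[of _ "a' / a"]) (auto simp: field_simps)
  next
    case 2
    with assms have "b' \<noteq> 0" by (auto simp: zero_prod_def)
    with 2 assms show ?thesis by (intro exI[of _ "b' / b"]) (auto simp: field_simps)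
  next
    case 3
    with assms have "c' \<noteq> 0" by (auto simp: zero_prod_def)
    with 3 assms show ?thesis by (intro exI[of _ "c' / c"]) (auto simp: field_simps)
  qed
  then show ?thesis using hpt_scale by metis
qed

text \<open>The affine curve is the finite part of the compactified one.\<close>

lemma embed_image:
  "embed D ` level_curve D E =
     {hpt2 ((x, s, w), (A1, A2, A0)) | x s w A1 A2 A0.
        on_cone D E ((x, s, w), (A1, A2, A0)) \<and> w \<noteq> 0 \<and> A0 \<noteq> 0}"
  (is "?L = ?R")
proof (intro equalityI subsetI)
  fix p assume "p \<in> ?L"
  then obtain y where "y \<in> level_curve D E" "p = embed D y" by (elim imageE)
  moreover obtain x A1 A2 where y: "y = (x, A1, A2)" by (cases y)
  ultimately have p: "p = hpt2 ((x, A2 + D - A1 * x, 1), (A1, A2, 1))"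
    and c: "(x, A1, A2) \<in> level_curve D E"
    by (simp_all only: embed.simps)
  from c have "on_cone D E ((x, A2 + D - A1 * x, 1), (A1, A2, 1))"
    by (simp add: level_curve_def zero_prod_def)
  with p show "p \<in> ?R"
    by (intro CollectI exI[of _ x] exI[of _ "A2 + D - A1 * x"] exI[of _ 1]
        exI[of _ A1] exI[of _ A2] conjI zero_neq_one[symmetric])
next
  fix p assume "p \<in> ?R"
  then obtain x s w A1 A2 A0 where p: "p = hpt2 ((x, s, w), (A1, A2, A0))"
    and on: "on_cone D E ((x, s, w), (A1, A2, A0))" and nz: "w \<noteq> 0" "A0 \<noteq> 0"
    by blast
  define X S a1 a2 where "X = x / w" and "S = s / w" and "a1 = A1 / A0" and "a2 = A2 / A0"
  with nz have eqs: "x = w * X" "s = w * S" "A1 = A0 * a1" "A2 = A0 * a2" by simp_all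
  have o: "x^2 + w^2 = s^2" "A1^2 + A2^2 - 4 * E * A2 * A0 = (1 + 2 * D * E) * A0^2"
    "s * A0 = A2 * w + D * w * A0 - A1 * x"
    using on unfolding on_cone.simps by blast+
  have "w^2 * (X^2 + 1 - S^2) = 0" "A0^2 * (a1^2 + a2^2 - 4 * E * a2 - (1 + 2 * D * E)) = 0"
    "w * A0 * (S - (a2 + D - a1 * X)) = 0"
    using o unfolding eqs by Groebner_Basis.algebra+
  with nz have X: "X^2 + 1 = S^2" "a1^2 + a2^2 - 4 * E * a2 = 1 + 2 * D * E"
    and S: "S = a2 + D - a1 * X"
    by (simp_all only: mult_eq_0_iff power_eq_0_iff right_minus_eq simp_thms)
  have "(X, a1, a2) \<in> level_curve D E"
    using X by (simp add: level_curve_def S)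
  moreover have "p = embed D (X, a1, a2)"
    using hpt_scale[OF nz(1), of X S 1] hpt_scale[OF nz(2), of a1 a2 1]
    unfolding p eqs embed.simps hpt2.simps S[symmetric] mult_1_right by simp
  ultimately show "p \<in> ?L" by (rule rev_image_eqI)
qed

lemma inj_embed: "inj (embed D)"
proof (rule injI)
  fix p p' assume "embed D p = embed D p'"
  moreover obtain x A1 A2 where "p = (x, A1, A2)" by (cases p)
  moreover obtain x' A1' A2' where "p' = (x', A1', A2')" by (cases p')
  ultimately have pp: "p = (x, A1, A2)" "p' = (x', A1', A2')"
    and "hpt (x, A2 + D - A1 * x, 1) = hpt (x', A2' + D - A1' * x', 1)"
    and "hpt (A1, A2, 1) = hpt (A1', A2', 1)"
    by (simp_all del: hpt.simps)
  from this(3,4) show "p = p'"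
    unfolding pp by (elim hpt_eqD) simp
qed

text \<open>Both involutions exchange the two intersection points of a line with a conic. Choosing a
  vector \<open>u\<close> in the plane of the line, this is the orthogonal reflection that maps \<open>u\<close> to \<open>- u\<close>;
  the three choices of \<open>u\<close> below give formulas that together cover the curve.\<close>

fun perp :: "nat \<Rightarrow> complex \<times> complex \<times> complex \<Rightarrow> complex \<times> complex \<times> complex" where
  "perp k (p, q, r) = (if k = 0 then (q, - p, 0) else if k = 1 then (r, 0, - p) else (0, r, - q))"

fun quad :: "complex \<times> complex \<times> complex \<times> complex \<Rightarrow> complex \<times> complex \<times> complex \<Rightarrow> complex" where
  "quad (\<alpha>, \<beta>, \<gamma>, \<delta>) (x, y, z) = \<alpha> * x^2 + \<beta> * y^2 + \<gamma> * z^2 + \<delta> * y * z"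

fun reflect :: "complex \<times> complex \<times> complex \<times> complex \<Rightarrow> complex \<times> complex \<times> complex \<Rightarrow>
    complex \<times> complex \<times> complex \<Rightarrow> complex \<times> complex \<times> complex" where
  "reflect (\<alpha>, \<beta>, \<gamma>, \<delta>) (x, y, z) (x', y', z') =
    (let Q = \<alpha> * x^2 + \<beta> * y^2 + \<gamma> * z^2 + \<delta> * y * z;
         B = 2 * \<alpha> * x * x' + 2 * \<beta> * y * y' + 2 * \<gamma> * z * z' + \<delta> * (y * z' + z * y')
     in (Q * x' - B * x, Q * y' - B * y, Q * z' - B * z))"

fun dot3 :: "complex \<times> complex \<times> complex \<Rightarrow> complex \<times> complex \<times> complex \<Rightarrow> complex" where
  "dot3 (p, q, r) (x, y, z) = p * x + q * y + r * z"

fun scale3 :: "complex \<Rightarrow> complex \<times> complex \<times> complex \<Rightarrow> complex \<times> complex \<times> complex" where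
  "scale3 k (x, y, z) = (k * x, k * y, k * z)"

lemma hpt_scale3: "k \<noteq> 0 \<Longrightarrow> hpt (scale3 k u) = hpt u"
  by (cases u) (simp add: hpt_scale del: hpt.simps)

lemma hpt_eqD3: "hpt u = hpt v \<Longrightarrow> \<exists>k. k \<noteq> 0 \<and> v = scale3 k u"
  by (cases u; cases v) (metis hpt_eqD scale3.simps)

lemma scale3_eq_0: "scale3 k u = 0 \<longleftrightarrow> k = 0 \<or> u = 0"
  by (cases u) (auto simp: zero_prod_def)

lemma perp_scale3: "perp k (scale3 l n) = scale3 l (perp k n)"
  by (cases n) auto

lemma quad_scale3: "quad f (scale3 l u) = l^2 * quad f u"
  by (cases f; cases u) (auto simp: power_mult_distrib algebra_simps power2_eq_square)

lemma reflect_scale3: "reflect f (scale3 k u) (scale3 l v) = scale3 (k^2 * l) (reflect f u v)"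
  by (cases f; cases u; cases v) (auto simp: Let_def algebra_simps power2_eq_square)

lemma reflect_reflect: "reflect f u (reflect f u v) = scale3 ((quad f u)^2) v"
proof (cases f; cases u; cases v)
  fix \<alpha> \<beta> \<gamma> \<delta> x y z x' y' z'
  assume *: "f = (\<alpha>, \<beta>, \<gamma>, \<delta>)" "u = (x, y, z)" "v = (x', y', z')"
  show ?thesis
    unfolding * reflect.simps quad.simps scale3.simps Let_def prod.inject
    by (intro conjI; Groebner_Basis.algebra)
qed

lemma quad_reflect: "quad f (reflect f u v) = (quad f u)^2 * quad f v"
proof (cases f; cases u; cases v)
  fix \<alpha> \<beta> \<gamma> \<delta> x y z x' y' z'
  assume *: "f = (\<alpha>, \<beta>, \<gamma>, \<delta>)" "u = (x, y, z)" "v = (x', y', z')"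
  show ?thesis
    unfolding * reflect.simps quad.simps Let_def by Groebner_Basis.algebra
qed

lemma dot3_reflect:
  assumes "dot3 n u = 0" "dot3 n v = 0"
  shows "dot3 n (reflect f u v) = 0"
proof -
  obtain p q r x y z x' y' z' \<alpha> \<beta> \<gamma> \<delta> where *: "f = (\<alpha>, \<beta>, \<gamma>, \<delta>)"
    "u = (x, y, z)" "v = (x', y', z')" "n = (p, q, r)"
    by (cases f; cases u; cases v; cases n)
  have "p * (Q * x' - B * x) + q * (Q * y' - B * y) + r * (Q * z' - B * z) = 0" for Q B
    using assms unfolding * dot3.simps by Groebner_Basis.algebra
  then show ?thesis by (simp add: * Let_def del: mult_eq_0_iff)
qed

lemma dot3_perp: "dot3 n (perp k n) = 0"
  by (cases n) auto

lemma reflect_nonzero: "quad f u \<noteq> 0 \<Longrightarrow> v \<noteq> 0 \<Longrightarrow> reflect f u v \<noteq> 0"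
proof
  assume *: "quad f u \<noteq> 0" "v \<noteq> 0" "reflect f u v = 0"
  have "reflect f u 0 = 0"
    by (cases f; cases u) (auto simp: Let_def zero_prod_def)
  with * reflect_reflect[of f u v] show False by (simp add: scale3_eq_0)
qed

context
  fixes \<alpha> \<beta> \<gamma> \<delta> p q r x y z Q0 B0 Q1 B1 Q2 B2 :: complex
  assumes line: "p * x + q * y + r * z = 0"
    and conic: "\<alpha> * x^2 + \<beta> * y^2 + \<gamma> * z^2 + \<delta> * y * z = 0"
    and Q0: "Q0 = \<alpha> * q^2 + \<beta> * p^2" and B0: "B0 = 2 * \<alpha> * q * x - 2 * \<beta> * p * y - \<delta> * p * z"
    and Q1: "Q1 = \<alpha> * r^2 + \<gamma> * p^2" and B1: "B1 = 2 * \<alpha> * r * x - 2 * \<gamma> * p * z - \<delta> * p * y"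
    and Q2: "Q2 = \<beta> * r^2 + \<gamma> * q^2 - \<delta> * r * q"
    and B2: "B2 = 2 * \<beta> * r * y - 2 * \<gamma> * q * z + \<delta> * (r * z - q * y)"
begin

lemma reflect_perp:
  "reflect (\<alpha>, \<beta>, \<gamma>, \<delta>) (perp 0 (p, q, r)) (x, y, z) = (Q0 * x - B0 * q, Q0 * y + B0 * p, Q0 * z)"
  "reflect (\<alpha>, \<beta>, \<gamma>, \<delta>) (perp 1 (p, q, r)) (x, y, z) = (Q1 * x - B1 * r, Q1 * y, Q1 * z + B1 * p)"
  "reflect (\<alpha>, \<beta>, \<gamma>, \<delta>) (perp 2 (p, q, r)) (x, y, z) = (Q2 * x, Q2 * y - B2 * r, Q2 * z + B2 * q)"
  by (simp_all add: Q0 B0 Q1 B1 Q2 B2 Let_def algebra_simps)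

lemma reflect_perp_cross:
  "(Q0 * x - B0 * q) * (Q1 * y) = (Q0 * y + B0 * p) * (Q1 * x - B1 * r)"
  "(Q0 * x - B0 * q) * (Q1 * z + B1 * p) = (Q0 * z) * (Q1 * x - B1 * r)"
  "(Q0 * y + B0 * p) * (Q1 * z + B1 * p) = (Q0 * z) * (Q1 * y)"
  "(Q0 * x - B0 * q) * (Q2 * y - B2 * r) = (Q0 * y + B0 * p) * (Q2 * x)"
  "(Q0 * x - B0 * q) * (Q2 * z + B2 * q) = (Q0 * z) * (Q2 * x)"
  "(Q0 * y + B0 * p) * (Q2 * z + B2 * q) = (Q0 * z) * (Q2 * y - B2 * r)"
  "(Q1 * x - B1 * r) * (Q2 * y - B2 * r) = (Q1 * y) * (Q2 * x)"
  "(Q1 * x - B1 * r) * (Q2 * z + B2 * q) = (Q1 * z + B1 * p) * (Q2 * x)"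
  "(Q1 * y) * (Q2 * z + B2 * q) = (Q1 * z + B1 * p) * (Q2 * y - B2 * r)"
proof -
  show "(Q0 * x - B0 * q) * (Q1 * y) = (Q0 * y + B0 * p) * (Q1 * x - B1 * r)"
    "(Q0 * x - B0 * q) * (Q1 * z + B1 * p) = (Q0 * z) * (Q1 * x - B1 * r)"
    "(Q0 * y + B0 * p) * (Q1 * z + B1 * p) = (Q0 * z) * (Q1 * y)"
    using line conic Q0 B0 Q1 B1 by Groebner_Basis.algebra+
  show "(Q0 * x - B0 * q) * (Q2 * y - B2 * r) = (Q0 * y + B0 * p) * (Q2 * x)"
    "(Q0 * x - B0 * q) * (Q2 * z + B2 * q) = (Q0 * z) * (Q2 * x)"
    "(Q0 * y + B0 * p) * (Q2 * z + B2 * q) = (Q0 * z) * (Q2 * y - B2 * r)"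
    using line conic Q0 B0 Q2 B2 by Groebner_Basis.algebra+
  show "(Q1 * x - B1 * r) * (Q2 * y - B2 * r) = (Q1 * y) * (Q2 * x)"
    "(Q1 * x - B1 * r) * (Q2 * z + B2 * q) = (Q1 * z + B1 * p) * (Q2 * x)"
    "(Q1 * y) * (Q2 * z + B2 * q) = (Q1 * z + B1 * p) * (Q2 * y - B2 * r)"
    using line conic Q1 B1 Q2 B2 by Groebner_Basis.algebra+
qed

end

lemma reflect_consistent:
  assumes "dot3 n v = 0" "quad f v = 0" "v \<noteq> 0"
    and "quad f (perp k n) \<noteq> 0" "quad f (perp l n) \<noteq> 0"
  shows "hpt (reflect f (perp k n) v) = hpt (reflect f (perp l n) v)"
proof -
  obtain \<alpha> \<beta> \<gamma> \<delta> where f: "f = (\<alpha>, \<beta>, \<gamma>, \<delta>)" by (cases f)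
  obtain p q r where n: "n = (p, q, r)" by (cases n)
  obtain x y z where v: "v = (x, y, z)" by (cases v)
  have h: "p * x + q * y + r * z = 0" "\<alpha> * x^2 + \<beta> * y^2 + \<gamma> * z^2 + \<delta> * y * z = 0"
    using assms(1,2) by (auto simp: f n v)
  note refl_perp = reflect_perp[OF h refl refl refl refl refl refl]
  note cross = reflect_perp_cross[OF h refl refl refl refl refl refl]
  have nz: "reflect f (perp k n) v \<noteq> 0" if "quad f (perp k n) \<noteq> 0" for k
    using reflect_nonzero[OF that assms(3)] .
  have key: "hpt (reflect f (perp k n) v) = hpt (reflect f (perp l n) v)"
    if "quad f (perp k n) \<noteq> 0" "quad f (perp l n) \<noteq> 0"
      "k = 0 \<and> l = 1 \<or> k = 0 \<and> l = 2 \<or> k = 1 \<and> l = 2" for k l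
    using that(3)
  proof (elim disjE conjE)
    assume kl: "k = 0" "l = 1"
    show ?thesis
      using nz[OF that(1)] nz[OF that(2)] unfolding kl f n v refl_perp
      by (rule hpt_eqI[OF _ _ cross(1-3)])
  next
    assume kl: "k = 0" "l = 2"
    show ?thesis
      using nz[OF that(1)] nz[OF that(2)] unfolding kl f n v refl_perp
      by (rule hpt_eqI[OF _ _ cross(4-6)])
  next
    assume kl: "k = 1" "l = 2"
    show ?thesis
      using nz[OF that(1)] nz[OF that(2)] unfolding kl f n v refl_perp
      by (rule hpt_eqI[OF _ _ cross(7-9)])
  qed
  have big: "perp k n = perp (min k 2) n" for k
    by (cases k) (auto simp: n min_def)
  define K L where "K = min k 2" and "L = min l 2"
  then have K: "perp k n = perp K n" and L: "perp l n = perp L n"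
    using big[of k] big[of l] by simp_all
  have KL: "K = 0 \<or> K = 1 \<or> K = 2" "L = 0 \<or> L = 1 \<or> L = 2"
    unfolding K_def L_def by linarith+
  consider "K = L" | "K = 0 \<and> L = 1 \<or> K = 0 \<and> L = 2 \<or> K = 1 \<and> L = 2"
    | "L = 0 \<and> K = 1 \<or> L = 0 \<and> K = 2 \<or> L = 1 \<and> K = 2"
    using KL by fastforce
  moreover have q: "quad f (perp K n) \<noteq> 0" "quad f (perp L n) \<noteq> 0"
    using assms(4,5) unfolding K L .
  ultimately have "hpt (reflect f (perp K n) v) = hpt (reflect f (perp L n) v)"
  proof cases
    case 1
    then show ?thesis by (rule arg_cong)
  next
    case 2
    show ?thesis by (rule key[OF q 2])
  next
    case 3
    show ?thesis by (rule key[OF q(2,1) 3, symmetric])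
  qed
  then show ?thesis unfolding K L .
qed

lemma polynomial_fn_uminus: "polynomial_fn f \<Longrightarrow> polynomial_fn (\<lambda>z. - f z)"
  using polynomial_fn.mult[OF polynomial_fn.const[of "- 1"], of f] by simp

lemma polynomial_fn_diff:
  "polynomial_fn f \<Longrightarrow> polynomial_fn g \<Longrightarrow> polynomial_fn (\<lambda>z. f z - g z)"
  using polynomial_fn.add[of f "\<lambda>z. - g z"] polynomial_fn_uminus[of g] by simp

lemma polynomial_fn_square: "polynomial_fn f \<Longrightarrow> polynomial_fn (\<lambda>z. (f z)^2)"
  using polynomial_fn.mult[of f f] by (simp add: power2_eq_square)

lemmas polynomial_fn_intros = polynomial_fn.intros polynomial_fn_uminus polynomial_fn_diff
  polynomial_fn_square

lemma polynomial_triple_Pair: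
  "polynomial_fn f \<Longrightarrow> polynomial_fn g \<Longrightarrow> polynomial_fn h \<Longrightarrow>
   polynomial_triple (\<lambda>z. (f z, g z, h z))"
  by (simp add: polynomial_triple_def)

lemma polynomial_triple_scale3:
  assumes "polynomial_fn f" "polynomial_triple P"
  shows "polynomial_triple (\<lambda>z. scale3 (f z) (P z))"
proof -
  have "(\<lambda>z. scale3 (f z) (P z)) =
      (\<lambda>z. (f z * fst (P z), f z * fst (snd (P z)), f z * snd (snd (P z))))"
    by (intro ext) (metis scale3.simps prod.collapse)
  then show ?thesis
    using assms by (auto simp: polynomial_triple_def intro: polynomial_fn.mult)
qed

lemma polynomial_triple_perp:
  assumes "polynomial_triple P"
  shows "polynomial_triple (\<lambda>z. perp k (P z))"
proof -
  have *: "perp k u = (if k = 0 then (fst (snd u), - fst u, 0)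
      else if k = 1 then (snd (snd u), 0, - fst u) else (0, snd (snd u), - fst (snd u)))" for u
    by (cases u) auto
  show ?thesis
    using assms unfolding * polynomial_triple_def
    by (cases "k = 0"; cases "k = 1") (auto intro: polynomial_fn_intros)
qed

lemma polynomial_fn_quad:
  assumes "polynomial_triple P"
  shows "polynomial_fn (\<lambda>z. quad f (P z))"
proof -
  obtain \<alpha> \<beta> \<gamma> \<delta> where f: "f = (\<alpha>, \<beta>, \<gamma>, \<delta>)" by (cases f)
  have *: "quad f u = \<alpha> * (fst u)^2 + \<beta> * (fst (snd u))^2 + \<gamma> * (snd (snd u))^2
      + \<delta> * fst (snd u) * snd (snd u)" for u
    by (cases u) (simp add: f)
  show ?thesis
    using assms unfolding * polynomial_triple_def by (auto intro!: polynomial_fn_intros)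
qed

lemma polynomial_triple_reflect:
  assumes "polynomial_triple P" "polynomial_triple Q"
  shows "polynomial_triple (\<lambda>z. reflect f (P z) (Q z))"
proof -
  obtain \<alpha> \<beta> \<gamma> \<delta> where f: "f = (\<alpha>, \<beta>, \<gamma>, \<delta>)" by (cases f)
  define q where "q u = \<alpha> * (fst u)^2 + \<beta> * (fst (snd u))^2 + \<gamma> * (snd (snd u))^2
      + \<delta> * fst (snd u) * snd (snd u)" for u :: "complex \<times> complex \<times> complex"
  define b where "b u v = 2 * \<alpha> * fst u * fst v + 2 * \<beta> * fst (snd u) * fst (snd v)
      + 2 * \<gamma> * snd (snd u) * snd (snd v)
      + \<delta> * (fst (snd u) * snd (snd v) + snd (snd u) * fst (snd v))"
    for u v :: "complex \<times> complex \<times> complex"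
  have *: "reflect f u v = (q u * fst v - b u v * fst u, q u * fst (snd v) - b u v * fst (snd u),
      q u * snd (snd v) - b u v * snd (snd u))" for u v
    by (cases u; cases v) (simp add: f q_def b_def Let_def)
  show ?thesis
    using assms unfolding * polynomial_triple_def q_def b_def
    by (auto intro!: polynomial_fn_intros)
qed

lemma regular_map_cong:
  assumes "regular_map D E F" "\<And>p. p \<in> compact_curve D E \<Longrightarrow> G p = F p"
  shows "regular_map D E G"
  unfolding regular_map_def
proof (intro conjI allI impI)
  show "G \<in> compact_curve D E \<rightarrow> compact_curve D E"
    using assms by (auto simp: regular_map_def)
next
  fix z assume "on_cone D E z"
  with assms(1) obtain P Q where PQ: "polynomial_triple P" "polynomial_triple Q" "P z \<noteq> 0" "Q z \<noteq> 0"
    and F: "\<And>z'. on_cone D E z' \<Longrightarrow> P z' \<noteq> 0 \<Longrightarrow> Q z' \<noteq> 0 \<Longrightarrow> F (hpt2 z') = hpt2 (P z', Q z')"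
    unfolding regular_map_def by blast
  have "G (hpt2 z') = F (hpt2 z')" if "on_cone D E z'" for z'
    by (rule assms(2)) (use that in \<open>simp add: compact_curve_def del: hpt2.simps\<close>)
  with PQ F show "\<exists>P Q. polynomial_triple P \<and> polynomial_triple Q \<and> P z \<noteq> 0 \<and> Q z \<noteq> 0 \<and>
      (\<forall>z'. on_cone D E z' \<and> P z' \<noteq> 0 \<and> Q z' \<noteq> 0 \<longrightarrow> G (hpt2 z') = hpt2 (P z', Q z'))"
    by - (rule exI[of _ P], rule exI[of _ Q], simp del: hpt2.simps)
qed

lemma hpt2_conv: "hpt2 z = (hpt (fst z), hpt (snd z))"
  by (metis hpt2.simps prod.collapse)

lemma on_cone_nonzero: "on_cone D E z \<Longrightarrow> fst z \<noteq> 0 \<and> snd z \<noteq> 0"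
  by (induction D E z rule: on_cone.induct) simp

lemma glue:
  fixes P :: "nat \<Rightarrow> hvec2 \<Rightarrow> hvec2" and q :: "nat \<Rightarrow> hvec2 \<Rightarrow> complex"
  assumes curve: "\<And>k z. on_cone D E z \<Longrightarrow> q k z \<noteq> 0 \<Longrightarrow> on_cone D E (P k z)"
    and cover: "\<And>z. on_cone D E z \<Longrightarrow> \<exists>k. q k z \<noteq> 0"
    and consistent: "\<And>k l z. on_cone D E z \<Longrightarrow> q k z \<noteq> 0 \<Longrightarrow> q l z \<noteq> 0 \<Longrightarrow>
      hpt2 (P k z) = hpt2 (P l z)"
    and hom: "\<And>k z z'. on_cone D E z \<Longrightarrow> on_cone D E z' \<Longrightarrow> hpt2 z = hpt2 z' \<Longrightarrow> q k z \<noteq> 0 \<Longrightarrow>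
      q k z' \<noteq> 0 \<and> hpt2 (P k z) = hpt2 (P k z')"
    and invol: "\<And>k z. on_cone D E z \<Longrightarrow> q k z \<noteq> 0 \<Longrightarrow>
      q k (P k z) \<noteq> 0 \<and> hpt2 (P k (P k z)) = hpt2 z"
    and poly: "\<And>k. polynomial_fn (q k)" "\<And>k. polynomial_triple (\<lambda>z. fst (P k z))"
      "\<And>k. polynomial_triple (\<lambda>z. snd (P k z))"
  shows "\<exists>F. curve_automorphism D E F \<and>
    (\<forall>k z. on_cone D E z \<and> q k z \<noteq> 0 \<longrightarrow> F (hpt2 z) = hpt2 (P k z))"
proof -
  define rep where "rep p = (SOME z. on_cone D E z \<and> hpt2 z = p)" for p
  define idx where "idx z = (SOME k. q k z \<noteq> 0)" for z
  define F where "F p = hpt2 (P (idx (rep p)) (rep p))" for p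
  have rep: "on_cone D E (rep (hpt2 z)) \<and> hpt2 (rep (hpt2 z)) = hpt2 z" if "on_cone D E z" for z
    unfolding rep_def by (rule someI[of _ z]) (use that in simp)
  have idx: "q (idx z) z \<noteq> 0" if "on_cone D E z" for z
    unfolding idx_def using someI_ex[OF cover[OF that]] .
  have F: "F (hpt2 z) = hpt2 (P k z)" if "on_cone D E z" "q k z \<noteq> 0" for k z
  proof -
    let ?y = "rep (hpt2 z)"
    have y: "on_cone D E ?y" "hpt2 ?y = hpt2 z" using rep[OF that(1)] by auto
    have 1: "q k ?y \<noteq> 0" "hpt2 (P k ?y) = hpt2 (P k z)"
      using hom[OF that(1) y(1) _ that(2)] y(2) by auto
    show ?thesis
      unfolding F_def using consistent[OF y(1) idx[OF y(1)] 1(1)] 1(2) by simp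
  qed
  let ?C = "compact_curve D E"
  have inC: "F p \<in> ?C" if "p \<in> ?C" for p
  proof -
    from that obtain z where z: "on_cone D E z" "p = hpt2 z" by (auto simp: compact_curve_def)
    show ?thesis
      using F[OF z(1) idx[OF z(1)]] curve[OF z(1) idx[OF z(1)]] z(2)
      by (auto simp: compact_curve_def)
  qed
  have FF: "F (F p) = p" if "p \<in> ?C" for p
  proof -
    from that obtain z where z: "on_cone D E z" "p = hpt2 z" by (auto simp: compact_curve_def)
    have k: "q (idx z) z \<noteq> 0" using idx[OF z(1)] .
    have "F (F p) = F (hpt2 (P (idx z) z))" using F[OF z(1) k] z(2) by simp
    also have "\<dots> = hpt2 (P (idx z) (P (idx z) z))"
      using F[OF curve[OF z(1) k]] invol[OF z(1) k] by blast
    also have "\<dots> = p" using invol[OF z(1) k] z(2) by simp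
    finally show ?thesis .
  qed
  have bij: "bij_betw F ?C ?C"
    by (rule bij_betw_byWitness[of _ F]) (use inC FF in auto)
  have "regular_map D E F"
    unfolding regular_map_def
  proof (intro conjI allI impI)
    show "F \<in> ?C \<rightarrow> ?C" using inC by auto
  next
    fix z assume z: "on_cone D E z"
    then obtain k where k: "q k z \<noteq> 0" using cover by blast
    let ?P = "\<lambda>z. scale3 (q k z) (fst (P k z))"
    let ?Q = "\<lambda>z. scale3 (q k z) (snd (P k z))"
    have nz: "fst (P k z) \<noteq> 0 \<and> snd (P k z) \<noteq> 0"
      using on_cone_nonzero[OF curve[OF z k]] .
    have "F (hpt2 z') = hpt2 (?P z', ?Q z')"
      if "on_cone D E z'" "?P z' \<noteq> 0" for z'
    proof -
      have "q k z' \<noteq> 0" using that by (auto simp: scale3_eq_0)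
      then show ?thesis
        using F[OF that(1)] hpt_scale3 by (simp add: hpt2_conv del: hpt2.simps)
    qed
    then show "\<exists>P Q. polynomial_triple P \<and> polynomial_triple Q \<and> P z \<noteq> 0 \<and> Q z \<noteq> 0 \<and>
        (\<forall>z'. on_cone D E z' \<and> P z' \<noteq> 0 \<and> Q z' \<noteq> 0 \<longrightarrow> F (hpt2 z') = hpt2 (P z', Q z'))"
      using poly nz k
      by - (rule exI[of _ ?P], rule exI[of _ ?Q],
          auto simp: scale3_eq_0 intro: polynomial_triple_scale3)
  qed
  moreover have "inv_into ?C F p = F p" if "p \<in> ?C" for p
    using that inC FF bij by (metis bij_betw_def inv_into_f_f)
  ultimately have "curve_automorphism D E F"
    using bij regular_map_cong unfolding curve_automorphism_def by blast
  then show ?thesis using F by blast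
qed

fun line_of_fst :: "complex \<Rightarrow> complex \<times> complex \<times> complex \<Rightarrow> complex \<times> complex \<times> complex" where
  "line_of_fst D (x, s, w) = (x, - w, s - D * w)"

fun line_of_snd :: "complex \<Rightarrow> complex \<times> complex \<times> complex \<Rightarrow> complex \<times> complex \<times> complex" where
  "line_of_snd D (A1, A2, A0) = (A1, A0, - (A2 + D * A0))"

lemma on_cone_iff1:
  "on_cone D E (u, a) \<longleftrightarrow> u \<noteq> 0 \<and> a \<noteq> 0 \<and> quad (1, - 1, 1, 0) u = 0 \<and>
     quad (1, 1, - (1 + 2 * D * E), - 4 * E) a = 0 \<and> dot3 (line_of_snd D a) u = 0"
  by (cases u; cases a) (auto simp: algebra_simps)

lemma on_cone_iff2:
  "on_cone D E (u, a) \<longleftrightarrow> u \<noteq> 0 \<and> a \<noteq> 0 \<and> quad (1, - 1, 1, 0) u = 0 \<and>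
     quad (1, 1, - (1 + 2 * D * E), - 4 * E) a = 0 \<and> dot3 (line_of_fst D u) a = 0"
  by (cases u; cases a) (auto simp: algebra_simps)

lemma line_scale3:
  "line_of_fst D (scale3 k u) = scale3 k (line_of_fst D u)"
  "line_of_snd D (scale3 k u) = scale3 k (line_of_snd D u)"
  by (cases u; auto simp: algebra_simps)+

lemma polynomial_triple_line:
  "polynomial_triple (\<lambda>z. line_of_fst D (fst z))" "polynomial_triple (\<lambda>z. line_of_snd D (snd z))"
proof -
  have "line_of_fst D u = (fst u, - snd (snd u), fst (snd u) - D * snd (snd u))"
    "line_of_snd D u = (fst u, snd (snd u), - (fst (snd u) + D * snd (snd u)))" for u
    by (cases u; simp)+
  then show "polynomial_triple (\<lambda>z. line_of_fst D (fst z))"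
    "polynomial_triple (\<lambda>z. line_of_snd D (snd z))"
    by (auto intro!: polynomial_triple_Pair polynomial_fn_intros)
qed

lemma polynomial_triple_proj:
  "polynomial_triple (\<lambda>z. fst z)" "polynomial_triple (\<lambda>z. snd z)"
  by (auto simp: polynomial_triple_def intro: polynomial_fn_intros)

lemma cover_fst:
  assumes "on_cone D E (u, a)"
  shows "\<exists>k. quad (1, - 1, 1, 0) (perp k (line_of_snd D a)) \<noteq> 0"
proof (rule ccontr)
  assume *: "\<not> ?thesis"
  obtain A1 A2 A0 where a: "a = (A1, A2, A0)" by (cases a)
  have "quad (1, - 1, 1, 0) (perp k (line_of_snd D a)) = 0" for k using * by blast
  from this[of 0] this[of 1] this[of 2]
  have "A0^2 - A1^2 = 0" "(A2 + D * A0)^2 + A1^2 = 0" "A0^2 - (A2 + D * A0)^2 = 0"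
    by (auto simp: a algebra_simps power2_eq_square)
  then have "2 * A1^2 = 0" "A0^2 = A1^2" "(A2 + D * A0)^2 = - (A1^2)" by Groebner_Basis.algebra+
  then have "A1 = 0" "A0 = 0" "A2 = 0" by auto
  with on_cone_nonzero[OF assms] show False by (simp add: a zero_prod_def)
qed

lemma cover_snd:
  assumes "on_cone D E (u, a)"
  shows "\<exists>k. quad (1, 1, - (1 + 2 * D * E), - 4 * E) (perp k (line_of_fst D u)) \<noteq> 0"
proof (rule ccontr)
  assume *: "\<not> ?thesis"
  obtain x s w where u: "u = (x, s, w)" by (cases u)
  have xs: "x^2 + w^2 = s^2" using assms by (cases a) (auto simp: u)
  have *: "quad (1, 1, - (1 + 2 * D * E), - 4 * E) (perp k (line_of_fst D u)) = 0" for k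
    using * by blast
  from *[of 0] have "w^2 + x^2 = 0" by (auto simp: u)
  with xs have s: "s = 0" by (simp add: add.commute)
  from *[of 1] have 1: "(D * w)^2 - (1 + 2 * D * E) * x^2 = 0"
    by (auto simp: u s algebra_simps)
  from *[of 2] have 2: "(D * w)^2 - (1 + 2 * D * E) * w^2 + 4 * E * D * w^2 = 0"
    by (auto simp: u s algebra_simps power2_eq_square)
  from 1 2 \<open>w^2 + x^2 = 0\<close> have "2 * w^2 = 0" by Groebner_Basis.algebra
  then have "w = 0" by simp
  with \<open>w^2 + x^2 = 0\<close> have "x = 0" by simp
  with assms \<open>w = 0\<close> s show False by (cases a) (auto simp: u zero_prod_def)
qed

lemma hpt2_eqD:
  assumes "hpt2 (u, a) = hpt2 (u', a')"
  obtains k l where "k \<noteq> 0" "l \<noteq> 0" "u' = scale3 k u" "a' = scale3 l a"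
  using assms hpt_eqD3[of u u'] hpt_eqD3[of a a'] by auto

lemma ex_extends_wall_exchange: "\<exists>I. extends_wall_exchange D E I"
proof -
  let ?f = "(1, - 1, 1, 0) :: complex \<times> complex \<times> complex \<times> complex"
  let ?u = "\<lambda>k a. perp k (line_of_snd D a)"
  have "\<exists>F. curve_automorphism D E F \<and>
    (\<forall>k z. on_cone D E z \<and> quad ?f (?u k (snd z)) \<noteq> 0 \<longrightarrow>
       F (hpt2 z) = hpt2 (reflect ?f (?u k (snd z)) (fst z), snd z))"
  proof (rule glue, goal_cases)
    case (1 k z)
    then show ?case
      by (cases z) (auto simp: on_cone_iff1 reflect_nonzero quad_reflect dot3_reflect dot3_perp
          simp del: on_cone.simps quad.simps reflect.simps dot3.simps perp.simps)
  next
    case (2 z)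
    then show ?case using cover_fst[of D E "fst z" "snd z"] by (simp only: prod.collapse)
  next
    case (3 k l z)
    have "dot3 (line_of_snd D (snd z)) (fst z) = 0" "quad ?f (fst z) = 0" "fst z \<noteq> 0"
      using 3(1) on_cone_iff1[of D E "fst z" "snd z"] unfolding prod.collapse by blast+
    from reflect_consistent[OF this 3(2,3)] show ?case by (simp only: hpt2.simps)
  next
    case (4 k z z')
    obtain u a u' a' where z: "z = (u, a)" "z' = (u', a')" by (cases z; cases z')
    from 4 obtain c d where "c \<noteq> 0" "d \<noteq> 0" "u' = scale3 c u" "a' = scale3 d a"
      unfolding z by (elim hpt2_eqD)
    with 4(4) show ?case
      by (simp add: z line_scale3 perp_scale3 quad_scale3 reflect_scale3 hpt_scale3
          del: on_cone.simps quad.simps reflect.simps dot3.simps perp.simps hpt.simps scale3.simps)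
  next
    case (5 k z)
    then show ?case
      by (cases z) (simp add: reflect_reflect hpt_scale3
          del: on_cone.simps quad.simps reflect.simps dot3.simps perp.simps hpt.simps scale3.simps)
  next
    case (6 k)
    show ?case by (intro polynomial_fn_quad polynomial_triple_perp polynomial_triple_line)
  next
    case (7 k)
    show ?case
      by (simp del: reflect.simps perp.simps)
        (intro polynomial_triple_reflect polynomial_triple_perp polynomial_triple_line
          polynomial_triple_proj)
  next
    case (8 k)
    show ?case by (simp add: polynomial_triple_proj)
  qed
  then obtain F where F: "curve_automorphism D E F"
    "\<And>k z. on_cone D E z \<Longrightarrow> quad ?f (?u k (snd z)) \<noteq> 0 \<Longrightarrow>
       F (hpt2 z) = hpt2 (reflect ?f (?u k (snd z)) (fst z), snd z)"
    by blast
  have "F (embed D (x, A1, A2)) = embed D (wall_exchange D (x, A1, A2))"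
    if c: "(x, A1, A2) \<in> level_curve D E" and nz: "1 - A1^2 \<noteq> 0" for x A1 A2
  proof -
    let ?z = "((x, A2 + D - A1 * x, 1), (A1, A2, 1)) :: hvec2"
    let ?x = "- 2 * (A2 + D) * A1 / (1 - A1^2) - x"
    have on: "on_cone D E ?z"
      using c by (auto simp: level_curve_def zero_prod_def)
    have x: "(1 - A1^2) * ?x = - 2 * (A2 + D) * A1 - (1 - A1^2) * x"
      using nz by (simp add: right_diff_distrib)
    have r: "reflect ?f (?u 0 (A1, A2, 1)) (x, A2 + D - A1 * x, 1) =
        scale3 (1 - A1^2) (?x, A2 + D - A1 * ?x, 1)"
      unfolding scale3.simps using x by (simp add: Let_def) Groebner_Basis.algebra
    have "F (embed D (x, A1, A2)) = hpt2 (reflect ?f (?u 0 (A1, A2, 1)) (x, A2 + D - A1 * x, 1), (A1, A2, 1))"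
      unfolding embed.simps using F(2)[OF on, of 0] nz by simp
    also have "\<dots> = embed D (?x, A1, A2)"
      unfolding r embed.simps hpt2.simps hpt_scale3[OF nz] ..
    finally show ?thesis by simp
  qed
  with F(1) show ?thesis unfolding extends_wall_exchange_def by blast
qed

lemma ex_extends_wall_reflection: "\<exists>J. extends_wall_reflection D E J"
proof -
  let ?f = "(1, 1, - (1 + 2 * D * E), - 4 * E) :: complex \<times> complex \<times> complex \<times> complex"
  let ?u = "\<lambda>k u. perp k (line_of_fst D u)"
  have "\<exists>F. curve_automorphism D E F \<and>
    (\<forall>k z. on_cone D E z \<and> quad ?f (?u k (fst z)) \<noteq> 0 \<longrightarrow>
       F (hpt2 z) = hpt2 (fst z, reflect ?f (?u k (fst z)) (snd z)))"
  proof (rule glue, goal_cases)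
    case (1 k z)
    then show ?case
      by (cases z) (auto simp: on_cone_iff2 reflect_nonzero quad_reflect dot3_reflect dot3_perp
          simp del: on_cone.simps quad.simps reflect.simps dot3.simps perp.simps)
  next
    case (2 z)
    then show ?case using cover_snd[of D E "fst z" "snd z"] by (simp only: prod.collapse)
  next
    case (3 k l z)
    have "dot3 (line_of_fst D (fst z)) (snd z) = 0" "quad ?f (snd z) = 0" "snd z \<noteq> 0"
      using 3(1) on_cone_iff2[of D E "fst z" "snd z"] unfolding prod.collapse by blast+
    from reflect_consistent[OF this 3(2,3)] show ?case by (simp only: hpt2.simps)
  next
    case (4 k z z')
    obtain u a u' a' where z: "z = (u, a)" "z' = (u', a')" by (cases z; cases z')
    from 4 obtain c d where "c \<noteq> 0" "d \<noteq> 0" "u' = scale3 c u" "a' = scale3 d a"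
      unfolding z by (elim hpt2_eqD)
    with 4(4) show ?case
      by (simp add: z line_scale3 perp_scale3 quad_scale3 reflect_scale3 hpt_scale3
          del: on_cone.simps quad.simps reflect.simps dot3.simps perp.simps hpt.simps scale3.simps)
  next
    case (5 k z)
    then show ?case
      by (cases z) (simp add: reflect_reflect hpt_scale3
          del: on_cone.simps quad.simps reflect.simps dot3.simps perp.simps hpt.simps scale3.simps)
  next
    case (6 k)
    show ?case by (intro polynomial_fn_quad polynomial_triple_perp polynomial_triple_line)
  next
    case (7 k)
    show ?case by (simp add: polynomial_triple_proj)
  next
    case (8 k)
    show ?case
      by (simp del: reflect.simps perp.simps)
        (intro polynomial_triple_reflect polynomial_triple_perp polynomial_triple_line
          polynomial_triple_proj)
  qed
  then obtain F where F: "curve_automorphism D E F"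
    "\<And>k z. on_cone D E z \<Longrightarrow> quad ?f (?u k (fst z)) \<noteq> 0 \<Longrightarrow>
       F (hpt2 z) = hpt2 (fst z, reflect ?f (?u k (fst z)) (snd z))"
    by blast
  have "F (embed D (x, A1, A2)) = embed D (wall_reflection E (x, A1, A2))"
    if c: "(x, A1, A2) \<in> level_curve D E" and nz: "x^2 + 1 \<noteq> 0" for x A1 A2
  proof -
    let ?z = "((x, A2 + D - A1 * x, 1), (A1, A2, 1)) :: hvec2"
    define a1 where "a1 = ((x^2 - 1) * A1 - 2 * x * A2 + 4 * x * E) / (x^2 + 1)"
    define a2 where "a2 = (- 2 * x * A1 - (x^2 - 1) * A2 + 4 * x^2 * E) / (x^2 + 1)"
    have on: "on_cone D E ?z"
      using c by (auto simp: level_curve_def zero_prod_def)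
    have a: "(x^2 + 1) * a1 = (x^2 - 1) * A1 - 2 * x * A2 + 4 * x * E"
      "(x^2 + 1) * a2 = - 2 * x * A1 - (x^2 - 1) * A2 + 4 * x^2 * E"
      using nz by (simp_all add: a1_def a2_def)
    have "(x^2 + 1) * (a2 + D - a1 * x) = (x^2 + 1) * (A2 + D - A1 * x)"
      using a by Groebner_Basis.algebra
    then have s: "a2 + D - a1 * x = A2 + D - A1 * x"
      using nz by (simp only: mult_cancel_left simp_thms)
    have r: "reflect ?f (?u 0 (x, A2 + D - A1 * x, 1)) (A1, A2, 1) = scale3 (x^2 + 1) (a1, a2, 1)"
      unfolding scale3.simps a by (simp add: Let_def algebra_simps power2_eq_square)
    have "quad ?f (?u 0 (fst ?z)) \<noteq> 0"
      using nz by (simp add: add.commute)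
    from F(2)[OF on this] have "F (embed D (x, A1, A2)) =
        hpt2 ((x, A2 + D - A1 * x, 1), reflect ?f (?u 0 (x, A2 + D - A1 * x, 1)) (A1, A2, 1))"
      by (simp only: embed.simps fst_conv snd_conv)
    also have "\<dots> = embed D (x, a1, a2)"
      unfolding r embed.simps hpt2.simps hpt_scale3[OF nz] s ..
    finally show ?thesis by (simp only: wall_reflection.simps a1_def a2_def)
  qed
  with F(1) show ?thesis unfolding extends_wall_reflection_def by blast
qed

end

theory Submission
  imports Defs
begin

text \<open>
  The level curve is isomorphic to the cubic curve \<open>y^2 = c(\<xi>)\<close>, where \<open>c\<close> is the polynomial under the
  square root in the theorem. As coordinate on the circle of Laplace-Runge-Lenz vectors \<open>(A1, A2)\<close> take
  its rational parameter \<open>v\<close>. A Kepler conic meets the wall in two points, which coincide over \<open>v = 0\<close>,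
  over \<open>v = \<infinity>\<close> and over two further values; so the level curve is a double cover of the \<open>v\<close>-line
  with a branch point at infinity, and \<open>\<xi>\<close> is an affine function of \<open>v\<close>. The involution \<open>I\<close>
  exchanges the sheets, \<open>y \<mapsto> - y\<close>. The involution \<open>J\<close> fixes \<open>x\<close>, and for fixed \<open>x\<close> the
  coordinates \<open>\<xi>\<close>, \<open>y\<close> lie on a line through a fixed point over \<open>\<xi> = 0\<close> (\<open>reflection_chord\<close>). Hence the
  Boltzmann map is the translation by a point \<open>p\<close> over \<open>\<xi> = 0\<close> in the group law of the cubic.

  It remains to see when \<open>n p = 0\<close>. As for the Poncelet problem, following Cayley, this holds if and
  only if there is a nonzero function on the cubic whose only pole is of order at most \<open>n\<close> at infinity and
  which vanishes to order \<open>n\<close> at \<open>p\<close>. Such a function is \<open>P(\<xi>) + y S(\<xi>)\<close> with bounds on the degrees,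
  and with \<open>y = \<Sum> B k \<xi>^k\<close> near \<open>p\<close> the order of vanishing becomes a system of linear equations for the
  coefficients of \<open>S\<close>, which has the Hankel matrix (\<open>hankel_det_eq_0_iff\<close>).

  The equivalence between closing of the orbit and existence of the function is proved for the orbit
  of one point without developing the group law or divisors (\<open>closes_iff\<close>): the product of the
  functions of the chords along the orbit is computed by a recursion for pairs of polynomials, and
  orders of vanishing are played off against degrees.

  The explicit formulas need points in general position. All but finitely many points of the
  compactified curve have such an orbit (\<open>finite_not_generic_orbit\<close>), every point is a limit of
  these (\<open>curve_point_limit\<close>), and iterates of the Boltzmann map are continuous, so that periodicity
  extends to all points (\<open>periodic_iff\<close>).
\<close>

section \<open>Pade approximation and Hankel determinants\<close>

lemma fps_X_power_dvd_iff:
  fixes f :: "'a :: field fps"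
  shows "fps_X ^ n dvd f \<longleftrightarrow> (\<forall>k<n. fps_nth f k = 0)"
proof (cases "f = 0")
  case False
  then have "fps_X ^ n dvd f \<longleftrightarrow> n \<le> subdegree f"
    by (simp add: fps_dvd_iff fps_X_power_subdegree)
  also have "\<dots> \<longleftrightarrow> (\<forall>k<n. fps_nth f k = 0)"
    using False by (meson linorder_not_le nth_less_subdegree_zero nth_subdegree_nonzero order.strict_trans2)
  finally show ?thesis .
qed simp

lemma poly_eq_0_if_fps_X_power_dvd:
  fixes p :: "'a :: field poly"
  assumes "fps_X ^ n dvd fps_of_poly p" "degree p < n"
  shows "p = 0"
proof (rule poly_eqI)
  fix k
  show "coeff p k = coeff 0 k"
    using assms by (cases "k < n") (auto simp: fps_X_power_dvd_iff coeff_eq_0)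
qed

lemma poly_eq_monom_if_fps_X_power_dvd:
  fixes p :: "'a :: field poly"
  assumes "fps_X ^ n dvd fps_of_poly p" "degree p \<le> n"
  obtains \<kappa> where "p = monom \<kappa> n"
proof
  show "p = monom (coeff p n) n"
  proof (rule poly_eqI)
    fix k
    show "coeff p k = coeff (monom (coeff p n) n) k"
      using assms by (cases k n rule: linorder_cases) (auto simp: fps_X_power_dvd_iff coeff_eq_0)
  qed
qed

lemma fps_X_power_dvd_cancel:
  fixes f u :: "'a :: field fps"
  assumes "fps_X ^ n dvd u * f" "fps_nth u 0 \<noteq> 0"
  shows "fps_X ^ n dvd f"
  using assms by (simp add: dvd_mult_unit_iff' fps_is_unit_iff)

lemma coeff_Poly_map_upt: "coeff (Poly (map f [0..<n])) k = (if k < n then f k else 0)"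
  by (simp add: nth_default_def)

text \<open>With the summation reversed, the convolution that gives a coefficient of \<open>S * Y\<close> becomes a row of a
  Hankel matrix applied to the reversed coefficient vector of \<open>S\<close>.\<close>

lemma fps_nth_poly_mult:
  fixes S :: "'a :: field poly"
  assumes "degree S < N" "N \<le> Suc i"
  shows "fps_nth (fps_of_poly S * Y) i = (\<Sum>q<N. coeff S (N - Suc q) * fps_nth Y (i - (N - Suc q)))"
proof -
  have "fps_nth (fps_of_poly S * Y) i = (\<Sum>k=0..i. coeff S k * fps_nth Y (i - k))"
    by (simp add: fps_mult_nth)
  also have "\<dots> = (\<Sum>k<N. coeff S k * fps_nth Y (i - k))"
    by (rule sum.mono_neutral_right) (use assms in \<open>auto simp: coeff_eq_0\<close>)
  also have "\<dots> = (\<Sum>q<N. coeff S (N - Suc q) * fps_nth Y (i - (N - Suc q)))"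
    by (rule sum.nat_diff_reindex[symmetric])
  finally show ?thesis .
qed

text \<open>A kernel vector of the Hankel matrix is, read backwards, the coefficient list of a polynomial \<open>S\<close>
  such that \<open>S * Y\<close> has no terms of the degrees \<open>m + 1, \<dots>, m + N\<close>. The terms of degree at most \<open>m\<close> can
  be cancelled by a polynomial \<open>P\<close>. So the determinant vanishes exactly if some Pade approximant \<open>- P / S\<close>
  of \<open>Y\<close> is better than its number of coefficients suggests.\<close>

lemma hankel_det_eq_0_iff:
  fixes Y :: "'a :: field fps"
  assumes r: "m + 2 = N + r"
  shows "Determinant.det (Matrix.mat N N (\<lambda>(p, q). fps_nth Y (p + q + r))) = 0 \<longleftrightarrow>
    (\<exists>P S. degree P \<le> m \<and> S \<noteq> 0 \<and> degree S < N \<and>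
       fps_X ^ (m + N + 1) dvd fps_of_poly P + fps_of_poly S * Y)"
    (is "Determinant.det ?H = 0 \<longleftrightarrow> ?rhs")
proof -
  have nth: "fps_nth (fps_of_poly S * Y) (m + 1 + p) = (\<Sum>q<N. coeff S (N - Suc q) * fps_nth Y (p + q + r))"
    if "degree S < N" for S p
  proof -
    have "m + 1 + p - (N - Suc q) = p + q + r" if "q < N" for q
      using r that by linarith
    then show ?thesis
      using fps_nth_poly_mult[OF that, of "m + 1 + p" Y] r by simp
  qed
  have Hv: "(?H *\<^sub>v v) $ p = (\<Sum>q<N. v $ q * fps_nth Y (p + q + r))"
    if "p < N" "v \<in> carrier_vec N" for p v
    using that by (simp add: scalar_prod_def atLeast0LessThan mult.commute)
  have "Determinant.det ?H = 0 \<longleftrightarrow> (\<exists>v. v \<in> carrier_vec N \<and> v \<noteq> 0\<^sub>v N \<and> ?H *\<^sub>v v = 0\<^sub>v N)"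
    by (rule det_0_iff_vec_prod_zero_field) simp
  also have "\<dots> \<longleftrightarrow> ?rhs"
  proof
    assume "\<exists>v. v \<in> carrier_vec N \<and> v \<noteq> 0\<^sub>v N \<and> ?H *\<^sub>v v = 0\<^sub>v N"
    then obtain v where v: "v \<in> carrier_vec N" "v \<noteq> 0\<^sub>v N" and Hv0: "?H *\<^sub>v v = 0\<^sub>v N" by blast
    obtain q where q: "q < N" "v $ q \<noteq> 0"
      using v by (metis carrier_vecD eq_vecI index_zero_vec)
    define S where "S = Poly (map (\<lambda>k. v $ (N - Suc k)) [0..<N])"
    define P where "P = Poly (map (\<lambda>k. - fps_nth (fps_of_poly S * Y) k) [0..<m+1])"
    have coeff_S: "coeff S (N - Suc k) = v $ k" if "k < N" for k
      unfolding S_def coeff_Poly_map_upt using that by simp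
    have "S \<noteq> 0" using coeff_S[OF q(1)] q(2) by auto
    moreover have "degree S < N"
    proof -
      have "degree S \<le> N - 1"
        by (rule degree_le) (auto simp: S_def coeff_Poly_map_upt simp del: coeff_Poly_eq)
      with q(1) show ?thesis by simp
    qed
    moreover have "degree P \<le> m"
      by (rule degree_le) (simp add: P_def coeff_Poly_map_upt del: coeff_Poly_eq upt_Suc)
    moreover have "fps_X ^ (m + N + 1) dvd fps_of_poly P + fps_of_poly S * Y"
      unfolding fps_X_power_dvd_iff
    proof (intro allI impI)
      fix k assume k: "k < m + N + 1"
      show "fps_nth (fps_of_poly P + fps_of_poly S * Y) k = 0"
      proof (cases "k \<le> m")
        case True
        then show ?thesis by (simp add: P_def coeff_Poly_map_upt del: coeff_Poly_eq upt_Suc)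
      next
        case False
        then obtain p where p: "k = m + 1 + p" "p < N" using k
          by (metis add.assoc add.commute add_less_cancel_left le_add_diff_inverse not_less_eq_eq Suc_eq_plus1)
        have "fps_nth (fps_of_poly S * Y) k = (\<Sum>q<N. coeff S (N - Suc q) * fps_nth Y (p + q + r))"
          unfolding p(1) by (rule nth) fact
        also have "\<dots> = (?H *\<^sub>v v) $ p"
          unfolding Hv[OF p(2) v(1)] by (rule sum.cong) (simp_all add: coeff_S)
        also have "\<dots> = 0" using Hv0 p(2) by simp
        finally show ?thesis
          using False by (simp add: P_def coeff_Poly_map_upt del: coeff_Poly_eq upt_Suc)
      qed
    qed
    ultimately show ?rhs by blast
  next
    assume ?rhs
    then obtain P S where PS: "degree P \<le> m" "S \<noteq> 0" "degree S < N"
      "fps_X ^ (m + N + 1) dvd fps_of_poly P + fps_of_poly S * Y" by blast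
    define v where "v = vec N (\<lambda>q. coeff S (N - Suc q))"
    have v: "v \<in> carrier_vec N" by (simp add: v_def)
    have "v $ (N - Suc (degree S)) \<noteq> 0"
      using PS(2,3) by (simp add: v_def)
    then have "v \<noteq> 0\<^sub>v N" using PS(3) by auto
    moreover have "?H *\<^sub>v v = 0\<^sub>v N"
    proof (rule eq_vecI)
      fix p assume "p < dim_vec (0\<^sub>v N :: 'a vec)"
      then have p: "p < N" by simp
      have "(?H *\<^sub>v v) $ p = fps_nth (fps_of_poly S * Y) (m + 1 + p)"
        unfolding Hv[OF p v] nth[OF PS(3)] by (rule sum.cong) (simp_all add: v_def)
      also have "\<dots> = fps_nth (fps_of_poly P + fps_of_poly S * Y) (m + 1 + p)"
        using PS(1) by (simp add: coeff_eq_0)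
      also have "\<dots> = 0" using PS(4) p unfolding fps_X_power_dvd_iff by simp
      finally show "(?H *\<^sub>v v) $ p = 0\<^sub>v N $ p" using p by simp
    qed simp
    ultimately show "\<exists>v. v \<in> carrier_vec N \<and> v \<noteq> 0\<^sub>v N \<and> ?H *\<^sub>v v = 0\<^sub>v N" using v by blast
  qed
  finally show ?thesis .
qed

section \<open>Closing of an orbit of a translation on a cubic curve\<close>

text \<open>The next two lemmas are the algebra of one step \<open>(a, b) \<mapsto> (a', b')\<close> of the translation defined
  in the locale below; they say how the coefficient vector of a function changes under
  multiplication by the function of the chord.\<close>

lemma chord_identity:
  fixes x y a a' b b' l y0 c1 c2 c3 P S :: "'a :: idom"
  assumes "y^2 = y0^2 + c1 * x + c2 * x^2 + c3 * x^3"
    and "b = l * a + y0" "- b' = l * a' + y0"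
    and "c2 - l^2 = - c3 * (a + a')" "c1 - 2 * l * y0 = c3 * a * a'"
  shows "(x - a) * ((x - a') * (- l * P + (l^2 + c3 * x) * S) + (P - l * S) * (y + b')) =
    ((x - a) * P + S * (y + b)) * (y - l * x - y0)"
  using assms by Groebner_Basis.algebra


lemma chord_eigen_identity:
  fixes a a' b b' l y0 c1 c2 c3 P S x y :: "'a :: idom"
  assumes "b = l * a + y0" "- b' = l * a' + y0"
    and "c2 - l^2 = - c3 * (a + a')" "c1 - 2 * l * y0 = c3 * a * a'"
    and 1: "(x - a) * P + (b + y) * S = 0"
    and 2: "(y - b) * P + (c3 * (x^2 + x * a + a^2) + c2 * (x + a) + c1) * S = 0"
  shows "(x - a') * (- l * P + (l^2 + c3 * x) * S) + (b' + y) * (P - l * S) = 0"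
    and "(y - b') * (- l * P + (l^2 + c3 * x) * S) +
      (c3 * (x^2 + x * a' + a'^2) + c2 * (x + a') + c1) * (P - l * S) = 0"
  using assms by Groebner_Basis.algebra+

lemma cubic_not_square_multiple:
  fixes p s :: "'a :: idom poly"
  assumes "p^2 = [:c0, c1, c2, c3:] * s^2" "c3 \<noteq> 0" "s \<noteq> 0"
  shows False
proof -
  let ?c = "[:c0, c1, c2, c3:]"
  have c: "?c \<noteq> 0" "degree ?c = 3" using assms(2) by auto
  have "degree (p^2) = degree (?c * s^2)" by (simp only: assms(1))
  also have "\<dots> = 3 + 2 * degree s"
    using c assms(3) by (simp only: degree_mult_eq degree_power_eq power_eq_0_iff simp_thms)
  also have "degree (p^2) = 2 * degree p"
    by (cases "p = 0") (simp_all add: degree_power_eq)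
  finally have "2 * degree p = 3 + 2 * degree s" .
  then show False by presburger
qed

text \<open>Let \<open>y^2 = y0^2 + c1 \<xi> + c2 \<xi>^2 + c3 \<xi>^3\<close> be a cubic curve, \<open>p = (0, y0)\<close> and \<open>Q k = (a k, b k)\<close>.
  The line \<open>y = l k \<xi> + y0\<close> through \<open>p\<close> and \<open>Q k\<close> meets the curve again in
  \<open>(a (k+1), - b (k+1))\<close>, so that \<open>Q (k+1) = Q k + p\<close> in the group law with neutral element at
  infinity. The last two conditions compare the coefficients of
  \<open>c(\<xi>) - (l k \<xi> + y0)^2 = c3 \<xi> (\<xi> - a k) (\<xi> - a (k+1))\<close>; in this form they also cover tangents.
  The series \<open>Y\<close> is the expansion of \<open>y\<close> at \<open>p\<close>.\<close>

locale chord_orbit =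
  fixes c1 c2 c3 y0 :: "'a :: field_char_0" and Y :: "'a fps"
    and a b l :: "nat \<Rightarrow> 'a" and n :: nat
  assumes lead: "c3 \<noteq> 0"
    and Y_square: "Y^2 = fps_of_poly [:y0^2, c1, c2, c3:]" and Y_0: "fps_nth Y 0 = y0"
    and a_nonzero: "\<And>k. k \<le> n \<Longrightarrow> a k \<noteq> 0"
    and chord: "\<And>k. k < n \<Longrightarrow> b k = l k * a k + y0"
      "\<And>k. k < n \<Longrightarrow> - b (Suc k) = l k * a (Suc k) + y0"
      "\<And>k. k < n \<Longrightarrow> c2 - (l k)^2 = - c3 * (a k + a (Suc k))"
      "\<And>k. k < n \<Longrightarrow> c1 - 2 * l k * y0 = c3 * a k * a (Suc k)"
begin

text \<open>The function \<open>g k = (y - l k \<xi> - y0) / (\<xi> - a (k+1))\<close> has the divisor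
  \<open>Q k + p - Q (k+1) - \<infinity>\<close>. The product \<open>F k\<close> of \<open>g 0, \<dots>, g (k-1)\<close> has the divisor
  \<open>Q 0 + k p - Q k - k \<infinity>\<close>, so it can be written as \<open>P k + S k * e k\<close> with polynomials \<open>P k\<close>, \<open>S k\<close>
  and \<open>e k = (y + b k) / (\<xi> - a k)\<close>, a function with a simple pole at \<open>Q k\<close>. Expressing \<open>g k\<close> and
  \<open>e k * g k\<close> by \<open>1\<close> and \<open>e (k+1)\<close> gives the recursion.\<close>

fun P :: "nat \<Rightarrow> 'a poly" and S :: "nat \<Rightarrow> 'a poly" where
  "P 0 = 1"
| "S 0 = 0"
| "P (Suc k) = [:- l k:] * P k + [:(l k)^2, c3:] * S k"
| "S (Suc k) = P k - [:l k:] * S k"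

text \<open>This is \<open>(\<xi> - a k) * F k\<close>, expanded at \<open>p\<close>.\<close>

definition numer :: "nat \<Rightarrow> 'a fps" where
  "numer k = (fps_X - fps_const (a k)) * fps_of_poly (P k) + fps_of_poly (S k) * (Y + fps_const (b k))"

lemma numer_step:
  assumes "k < n"
  shows "(fps_X - fps_const (a k)) * numer (Suc k) =
    numer k * (Y - fps_const (l k) * fps_X - fps_const y0)"
proof -
  have pc: "fps_of_poly (pCons c q) = fps_const c + fps_X * fps_of_poly q" for c :: 'a and q
    by (simp add: fps_of_poly_pCons)
  have 1: "Y^2 = (fps_const y0)^2 + fps_const c1 * fps_X + fps_const c2 * fps_X^2 + fps_const c3 * fps_X^3"
    unfolding Y_square by (simp add: pc algebra_simps power2_eq_square power3_eq_cube)
  have 2: "fps_const (b k) = fps_const (l k) * fps_const (a k) + fps_const y0"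
    "- fps_const (b (Suc k)) = fps_const (l k) * fps_const (a (Suc k)) + fps_const y0"
    "fps_const c2 - (fps_const (l k))^2 = - fps_const c3 * (fps_const (a k) + fps_const (a (Suc k)))"
    "fps_const c1 - 2 * fps_const (l k) * fps_const y0 = fps_const c3 * fps_const (a k) * fps_const (a (Suc k))"
    by (simp_all only: fps_numeral_fps_const fps_const_mult fps_const_sub fps_const_add
        fps_const_neg fps_const_power chord[OF assms])
  have PS: "fps_of_poly (P (Suc k)) = - fps_const (l k) * fps_of_poly (P k) +
      ((fps_const (l k))^2 + fps_const c3 * fps_X) * fps_of_poly (S k)"
    "fps_of_poly (S (Suc k)) = fps_of_poly (P k) - fps_const (l k) * fps_of_poly (S k)"
    by (simp_all add: fps_of_poly_add fps_of_poly_diff fps_of_poly_mult pc power2_eq_square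
      fps_of_poly_smult algebra_simps)
  show ?thesis
    unfolding numer_def PS by (rule chord_identity[OF 1 2])
qed

lemma numer_vanishes: "k \<le> n \<Longrightarrow> fps_X ^ k dvd numer k"
proof (induction k)
  case (Suc k)
  have "fps_X ^ 1 dvd Y - fps_const (l k) * fps_X - fps_const y0"
    unfolding fps_X_power_dvd_iff by (simp add: Y_0)
  moreover have "fps_X ^ k dvd numer k" using Suc by simp
  ultimately have "fps_X ^ k * fps_X ^ 1 dvd (fps_X - fps_const (a k)) * numer (Suc k)"
    unfolding numer_step[OF Suc_le_lessD[OF Suc.prems]] by (rule mult_dvd_mono[rotated])
  then have "fps_X ^ Suc k dvd (fps_X - fps_const (a k)) * numer (Suc k)"
    by (simp only: power_add[symmetric] Suc_eq_plus1)
  then show ?case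
    by (rule fps_X_power_dvd_cancel) (use a_nonzero[of k] Suc.prems in simp)
qed simp

lemma degree_P_S: "degree (P k) \<le> k div 2" "degree (S k) \<le> (k - 1) div 2"
proof (induction k)
  case (Suc k)
  { case 1
    show ?case
    proof (cases "S k = 0")
      case True
      moreover have "degree ([:- l k:] * P k) \<le> Suc k div 2"
        using degree_mult_le[of "[:- l k:]" "P k"] Suc.IH(1) by simp
      ultimately show ?thesis by simp
    next
      case False
      then have "k > 0" by (cases k) auto
      then have "degree ([:(l k)^2, c3:] * S k) \<le> Suc k div 2"
        using degree_mult_le[of "[:(l k)^2, c3:]" "S k"] Suc.IH(2) lead by simp
      moreover have "degree ([:- l k:] * P k) \<le> Suc k div 2"
        using degree_mult_le[of "[:- l k:]" "P k"] Suc.IH(1) by simp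
      ultimately show ?thesis unfolding P.simps by (rule degree_add_le[rotated])
    qed
  next
    case 2
    have "degree ([:l k:] * S k) \<le> k div 2"
      using degree_mult_le[of "[:l k:]" "S k"] Suc.IH(2) by simp
    then show ?case using Suc.IH(1) by (simp add: degree_diff_le)
  }
qed simp_all

text \<open>\<open>F k\<close> vanishes at \<open>Q 0\<close>. To say this also when \<open>a k = a 0\<close>, where the pole of \<open>e k\<close> interferes, it
  is expressed by linear algebra: at \<open>\<xi> = a 0\<close>, the coordinates of \<open>F k\<close> are an eigenvector, for the
  eigenvalue \<open>- b 0\<close>, of the multiplication by \<open>y\<close> in the basis \<open>1, e k\<close>. The eigenvector stays
  nonzero because the determinant of one step of the recursion is \<open>- c3 \<xi>\<close>.\<close>

lemma P_S_eigenvector: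
  assumes "k \<le> n"
  shows "(a 0 - a k) * poly (P k) (a 0) + (b k + b 0) * poly (S k) (a 0) = 0 \<and>
    (b 0 - b k) * poly (P k) (a 0) +
      (c3 * ((a 0)^2 + a 0 * a k + (a k)^2) + c2 * (a 0 + a k) + c1) * poly (S k) (a 0) = 0 \<and>
    (poly (P k) (a 0) \<noteq> 0 \<or> poly (S k) (a 0) \<noteq> 0)"
  using assms
proof (induction k)
  case (Suc k)
  then have k: "k < n" by simp
  have IH: "(a 0 - a k) * poly (P k) (a 0) + (b k + b 0) * poly (S k) (a 0) = 0"
    "(b 0 - b k) * poly (P k) (a 0) +
      (c3 * ((a 0)^2 + a 0 * a k + (a k)^2) + c2 * (a 0 + a k) + c1) * poly (S k) (a 0) = 0"
    "poly (P k) (a 0) \<noteq> 0 \<or> poly (S k) (a 0) \<noteq> 0"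
    using Suc by auto
  have PS: "poly (P (Suc k)) (a 0) = - l k * poly (P k) (a 0) + ((l k)^2 + c3 * a 0) * poly (S k) (a 0)"
    "poly (S (Suc k)) (a 0) = poly (P k) (a 0) - l k * poly (S k) (a 0)"
    by (simp_all add: algebra_simps)
  have "poly (P (Suc k)) (a 0) \<noteq> 0 \<or> poly (S (Suc k)) (a 0) \<noteq> 0"
  proof (rule ccontr)
    assume "\<not> ?thesis"
    then have 0: "- l k * poly (P k) (a 0) + ((l k)^2 + c3 * a 0) * poly (S k) (a 0) = 0"
      "poly (P k) (a 0) - l k * poly (S k) (a 0) = 0"
      unfolding PS by blast+
    then have "c3 * a 0 * poly (S k) (a 0) = 0" by Groebner_Basis.algebra
    with lead a_nonzero[of 0] have "poly (S k) (a 0) = 0" by simp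
    with 0(2) IH(3) show False by simp
  qed
  with chord_eigen_identity[OF chord[OF k] IH(1,2)] show ?case
    unfolding PS by blast
qed simp

lemma fps_of_poly_monic_linear: "fps_of_poly [:- c, 1:] = fps_X - fps_const c" for c :: 'a
  by (simp add: fps_of_poly_pCons fps_const_neg[symmetric] del: fps_const_neg)

text \<open>If the orbit closes, the divisor of \<open>F n\<close> is \<open>n p - n \<infinity>\<close>, so \<open>F n\<close> is a polynomial in \<open>\<xi>\<close> and \<open>y\<close>
  and is the required function. Conversely, if \<open>f = p + s y\<close> has this divisor, then comparing
  divisors shows that \<open>F n / f\<close> has at most a simple pole, hence is constant, and \<open>Q n = Q 0\<close>. The
  degree bounds on \<open>p\<close> and \<open>s\<close> say that the pole of \<open>f\<close> at infinity has order at most \<open>n\<close>, as \<open>\<xi>\<close>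
  has a double and \<open>y\<close> a triple pole there. Both implications below avoid divisors:
  orders of vanishing at \<open>p\<close> are compared with degrees.\<close>

theorem closes_iff:
  assumes "b 0 \<noteq> 0" "n > 0"
  shows "a n = a 0 \<and> b n = b 0 \<longleftrightarrow>
    (\<exists>p s. degree p \<le> n div 2 \<and> s \<noteq> 0 \<and> degree s < (n - 1) div 2 \<and>
       fps_X ^ n dvd fps_of_poly p + fps_of_poly s * Y)" (is "?L \<longleftrightarrow> ?R")
proof
  assume L: ?L
  have "2 * b 0 * poly (S n) (a 0) = 0"
    using P_S_eigenvector[of n] L by simp
  with assms have S0: "poly (S n) (a 0) = 0" by simp
  \<comment> \<open>so \<open>e n\<close> occurs in \<open>F n\<close> only multiplied by \<open>\<xi> - a n\<close>\<close>
  then obtain s where s: "S n = [:- a 0, 1:] * s" by (auto simp: poly_eq_0_iff_dvd)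
  define p where "p = P n + [:b 0:] * s"
  have "(fps_X - fps_const (a 0)) * (fps_of_poly p + fps_of_poly s * Y) = numer n"
    using L by (simp add: numer_def s p_def fps_of_poly_add fps_of_poly_mult fps_of_poly_monic_linear
        fps_of_poly_const algebra_simps del: mult_pCons_left mult_pCons_right)
  then have "fps_X ^ n dvd (fps_X - fps_const (a 0)) * (fps_of_poly p + fps_of_poly s * Y)"
    using numer_vanishes[of n] by simp
  then have dvd: "fps_X ^ n dvd fps_of_poly p + fps_of_poly s * Y"
    by (rule fps_X_power_dvd_cancel) (use a_nonzero[of 0] in simp)
  have s_nz: "s \<noteq> 0"
  proof
    assume "s = 0"
    then have "P n = 0"
      using dvd degree_P_S(1)[of n] assms(2)
      by (intro poly_eq_0_if_fps_X_power_dvd[of n]) (auto simp: p_def)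
    with P_S_eigenvector[of n] S0 show False by simp
  qed
  then have "degree (S n) = Suc (degree s)"
    unfolding s by (subst degree_mult_eq) auto
  with degree_P_S(2)[of n] have deg_s: "degree s < (n - 1) div 2" by simp
  have "degree p \<le> n div 2"
    unfolding p_def
  proof (rule degree_add_le)
    have "degree ([:b 0:] * s) \<le> degree s" using degree_mult_le[of "[:b 0:]" s] by simp
    with deg_s show "degree ([:b 0:] * s) \<le> n div 2" by linarith
  qed (rule degree_P_S)
  with s_nz deg_s dvd show ?R by blast
next
  assume ?R
  then obtain p s where deg: "degree p \<le> n div 2" "degree s < (n - 1) div 2" and s: "s \<noteq> 0"
    and dvd: "fps_X ^ n dvd fps_of_poly p + fps_of_poly s * Y" by blast
  let ?f = "fps_of_poly p + fps_of_poly s * Y"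
  let ?c = "[:y0^2, c1, c2, c3:]"
  \<comment> \<open>The coefficient of \<open>e n\<close> in the product of \<open>F n\<close> with the conjugate of \<open>f\<close>. It is divisible by \<open>\<xi>^n\<close>
      but of smaller degree. That it vanishes means that \<open>F n\<close> and \<open>f\<close> are proportional.\<close>
  have "S n * p - s * ([:- a n, 1:] * P n + [:b n:] * S n) = 0" (is "?K = 0")
  proof (rule poly_eq_0_if_fps_X_power_dvd)
    have "fps_of_poly ?K = fps_of_poly (S n) * ?f - fps_of_poly s * numer n"
      by (simp add: numer_def fps_of_poly_add fps_of_poly_diff fps_of_poly_mult
        fps_of_poly_monic_linear fps_of_poly_const algebra_simps del: mult_pCons_left mult_pCons_right)
    then show "fps_X ^ n dvd fps_of_poly ?K"
      using dvd numer_vanishes[of n] by (simp add: dvd_diff)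
    have "degree (S n * p) < n"
      using degree_mult_le[of "S n" p] deg(1) degree_P_S(2)[of n] assms(2) by linarith
    moreover have "degree (s * ([:- a n, 1:] * P n + [:b n:] * S n)) < n"
    proof -
      have "degree ([:- a n, 1:] * P n) \<le> Suc (n div 2)"
        using degree_mult_le[of "[:- a n, 1:]" "P n"] degree_P_S(1)[of n] by simp
      moreover have "degree ([:b n:] * S n) \<le> Suc (n div 2)"
        using degree_mult_le[of "[:b n:]" "S n"] degree_P_S(2)[of n] by simp
      ultimately have "degree ([:- a n, 1:] * P n + [:b n:] * S n) \<le> Suc (n div 2)"
        by (rule degree_add_le)
      then show ?thesis
        using degree_mult_le[of s "[:- a n, 1:] * P n + [:b n:] * S n"] deg(2) by linarith
    qed
    ultimately show "degree ?K < n" by (rule degree_diff_less)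
  qed
  then have "poly ?K (a 0) = 0" by (simp only: poly_0)
  then have "poly (S n) (a 0) * poly p (a 0) =
      poly s (a 0) * ((a 0 - a n) * poly (P n) (a 0) + b n * poly (S n) (a 0))"
    by (simp add: algebra_simps)
  moreover have "(a 0 - a n) * poly (P n) (a 0) + b n * poly (S n) (a 0) = - b 0 * poly (S n) (a 0)"
    using P_S_eigenvector[of n] by (simp add: algebra_simps add_eq_0_iff)
  ultimately have "poly (S n) (a 0) * poly p (a 0) = poly s (a 0) * (- b 0 * poly (S n) (a 0))"
    by (simp only:)
  then have "poly (S n) (a 0) * (poly p (a 0) + b 0 * poly s (a 0)) = 0"
    by (simp add: algebra_simps)
  moreover have "poly p (a 0) + b 0 * poly s (a 0) \<noteq> 0"
  proof
    assume 0: "poly p (a 0) + b 0 * poly s (a 0) = 0"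
    \<comment> \<open>The norm of \<open>f\<close> is a nonzero multiple of \<open>\<xi>^n\<close>, so that \<open>f\<close> has no zero away from \<open>\<xi> = 0\<close>.\<close>
    let ?norm = "p^2 - ?c * s^2"
    have norm_eq: "fps_of_poly ?norm = ?f * (fps_of_poly p - fps_of_poly s * Y)"
    proof -
      have "fps_of_poly ?norm = (fps_of_poly p)^2 - Y^2 * (fps_of_poly s)^2"
        by (simp only: fps_of_poly_diff fps_of_poly_mult fps_of_poly_power Y_square)
      also have "\<dots> = ?f * (fps_of_poly p - fps_of_poly s * Y)"
        by (simp add: algebra_simps power2_eq_square)
      finally show ?thesis .
    qed
    have norm_dvd: "fps_X ^ n dvd fps_of_poly ?norm"
      unfolding norm_eq by (rule dvd_mult2[OF dvd])
    have "degree (p^2) \<le> n"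
      using degree_power_le[of p 2] deg(1) by linarith
    moreover have "degree (?c * s^2) \<le> n"
    proof -
      have "degree ?c \<le> 3" by simp
      then show ?thesis
        using degree_mult_le[of ?c "s^2"] degree_power_le[of s 2] deg(2) by linarith
    qed
    ultimately have "degree ?norm \<le> n" by (rule degree_diff_le)
    with norm_dvd obtain \<kappa> where norm: "?norm = monom \<kappa> n"
      by (rule poly_eq_monom_if_fps_X_power_dvd)
    have "b 0 = l 0 * a 0 + y0" "c2 - (l 0)^2 = - c3 * (a 0 + a 1)"
      "c1 - 2 * l 0 * y0 = c3 * a 0 * a 1"
      using chord[of 0] assms(2) by simp_all
    then have on_curve: "y0^2 + a 0 * (c1 + a 0 * (c2 + a 0 * c3)) = (b 0)^2"
      by Groebner_Basis.algebra
    have "poly ?norm (a 0) = (poly p (a 0))^2 -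
        (y0^2 + a 0 * (c1 + a 0 * (c2 + a 0 * c3))) * (poly s (a 0))^2"
      by (simp add: algebra_simps)
    also have "\<dots> = (poly p (a 0) + b 0 * poly s (a 0)) * (poly p (a 0) - b 0 * poly s (a 0))"
      unfolding on_curve by (simp add: algebra_simps power2_eq_square)
    finally have "poly ?norm (a 0) = 0" unfolding 0 by (simp only: mult_zero_left)
    then have "\<kappa> * (a 0)^n = 0" unfolding norm poly_monom .
    then have "?norm = 0" unfolding norm using a_nonzero[of 0] by simp
    then have "p^2 = ?c * s^2" by (simp only: right_minus_eq)
    then show False using lead s by (rule cubic_not_square_multiple)
  qed
  ultimately have S0: "poly (S n) (a 0) = 0" by simp
  with P_S_eigenvector[of n] have "a n = a 0" "b n = b 0" by auto
  then show ?L by simp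
qed

end

section \<open>The level curve as a cubic curve\<close>

text \<open>The number \<open>j\<close> is one of the two square roots of \<open>-1\<close>. All formulas hold for both choices, and both
  are needed: they belong to the two branches of the square root in the expansion, and to the two
  points at infinity \<open>(1 : \<plusminus>j : 0)\<close> of the circle of Laplace-Runge-Lenz vectors.\<close>

locale kepler_wall =
  fixes D E R j :: complex
  assumes R_square: "R^2 = 1 + 2 * D * E + 4 * E^2" and R_nonzero: "R \<noteq> 0"
    and delta_nonzero: "D + 2 * E \<noteq> 0" and j_square: "j^2 = - 1"
begin

definition "\<delta> = D + 2 * E"

text \<open>The equation for \<open>(A1, A2)\<close> describes a circle with centre \<open>(0, 2 E)\<close> and radius \<open>R\<close>; this is its
  rational parameter \<open>v\<close>, with \<open>A1 + j (A2 - 2 E) = R v\<close> and \<open>A1 - j (A2 - 2 E) = R / v\<close>.\<close>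

definition vee :: "complex \<Rightarrow> complex \<Rightarrow> complex" where
  "vee A1 A2 = (A1 + j * (A2 - 2 * E)) / R"

text \<open>The level curve is a double cover of the \<open>v\<close>-line, branched at \<open>0\<close>, \<open>\<infinity>\<close> and where the Kepler conic
  touches the wall, hence birational to a cubic curve \<open>y^2 = c(\<xi>)\<close> with \<open>\<xi>\<close> an affine function of
  \<open>v\<close>. The constants are chosen so that \<open>c\<close> is the polynomial in the theorem. The coordinate \<open>y\<close>
  contains \<open>x + A1 s\<close>, which is half the difference of the two wall points times \<open>1 - A1^2\<close>.\<close>

definition xi :: "complex \<Rightarrow> complex \<Rightarrow> complex" where
  "xi A1 A2 = (R - j * \<delta> * vee A1 A2) / (2 * \<delta>)"

definition ypsilon :: "complex \<Rightarrow> complex \<Rightarrow> complex \<Rightarrow> complex" where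
  "ypsilon x A1 A2 = j * \<delta> * vee A1 A2 * (x + A1 * (A2 + D - A1 * x))"

lemma delta0: "\<delta> \<noteq> 0" using delta_nonzero by (simp add: \<delta>_def)

lemma R_vee: "R * vee A1 A2 = A1 + j * (A2 - 2 * E)"
  using R_nonzero by (simp add: vee_def)

lemma j0: "j \<noteq> 0" using j_square by auto

lemma circle:
  assumes "A1^2 + A2^2 - 4 * E * A2 = 1 + 2 * D * E"
  shows "vee A1 A2 * (A1 - j * (A2 - 2 * E)) = R"
proof -
  have "R * (vee A1 A2 * (A1 - j * (A2 - 2 * E)) - R) = 0"
    using R_vee[of A1 A2] R_square assms j_square by Groebner_Basis.algebra
  then show ?thesis using R_nonzero by simp
qed

lemma vee_nonzero:
  assumes "A1^2 + A2^2 - 4 * E * A2 = 1 + 2 * D * E"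
  shows "vee A1 A2 \<noteq> 0"
  using circle[OF assms] R_nonzero by auto

lemma A_from_vee:
  assumes "A1^2 + A2^2 - 4 * E * A2 = 1 + 2 * D * E" and "v = vee A1 A2"
  shows "2 * v * A1 = R * (v^2 + 1)" "2 * j * v * (A2 - 2 * E) = R * (v^2 - 1)"
proof -
  have 1: "v * (A1 - j * (A2 - 2 * E)) = R" "R * v = A1 + j * (A2 - 2 * E)"
    using circle[OF assms(1)] R_vee[of A1 A2] unfolding assms(2) .
  have "R * v^2 = v * (A1 + j * (A2 - 2 * E))"
    unfolding 1(2)[symmetric] by (simp add: power2_eq_square)
  then show "2 * v * A1 = R * (v^2 + 1)" "2 * j * v * (A2 - 2 * E) = R * (v^2 - 1)"
    using 1(1) by Groebner_Basis.algebra+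
qed

lemma vee_quadratic:
  assumes "A1^2 + A2^2 - 4 * E * A2 = 1 + 2 * D * E" and s: "s = A2 + D - A1 * x" and v: "v = vee A1 A2"
  shows "R * (1 - j * x) * v^2 + 2 * j * (\<delta> - s) * v - R * (1 + j * x) = 0"
  using A_from_vee[OF assms(1) v] j_square s unfolding \<delta>_def by Groebner_Basis.algebra

lemma wall_exchange_level:
  assumes c: "(x, A1, A2) \<in> level_curve D E" and nz: "1 - A1^2 \<noteq> 0"
    and x': "x' = - 2 * (A2 + D) * A1 / (1 - A1^2) - x"
  shows "(x', A1, A2) \<in> level_curve D E" "ypsilon x' A1 A2 = - ypsilon x A1 A2"
proof -
  have 1: "(1 - A1^2) * (x + x') = - 2 * (A2 + D) * A1"
    using nz x' by (simp add: field_simps)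
  have c1: "A1^2 + A2^2 - 4 * E * A2 = 1 + 2 * D * E" and c2: "x^2 + 1 = (A2 + D - A1 * x)^2"
    using c by (auto simp: level_curve_def)
  have "(x'^2 + 1) = (A2 + D - A1 * x')^2"
    using 1 c2 by Groebner_Basis.algebra
  with c1 show "(x', A1, A2) \<in> level_curve D E" by (simp add: level_curve_def)
  have "x' + A1 * (A2 + D - A1 * x') = - (x + A1 * (A2 + D - A1 * x))"
    using 1 by Groebner_Basis.algebra
  then show "ypsilon x' A1 A2 = - ypsilon x A1 A2"
    unfolding ypsilon_def by (simp only: mult_minus_right)
qed

text \<open>The equation of the level curve turns \<open>ypsilon\<close>, for a given point of the wall, into an affine function
  of \<open>\<xi>\<close>. Thus the two Kepler arcs that are exchanged by the reflection give two points on a line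
  through the fixed point \<open>(0, j R)\<close> of the cubic curve.\<close>

lemma ypsilon_chord:
  assumes c: "(x, A1, A2) \<in> level_curve D E" and q: "q * (1 - j * x) = A2 + D - A1 * x"
    and nz: "x^2 + 1 \<noteq> 0"
  shows "ypsilon x A1 A2 = j * R - 2 * j * \<delta> * (1 - \<delta> * q) * xi A1 A2"
proof -
  define v where "v = vee A1 A2"
  define s where "s = A2 + D - A1 * x"
  have c1: "A1^2 + A2^2 - 4 * E * A2 = 1 + 2 * D * E" and c2: "x^2 + 1 = s^2"
    using c by (auto simp: level_curve_def s_def)
  have xi: "2 * \<delta> * xi A1 A2 = R - j * \<delta> * v"
    using delta0 by (simp add: xi_def v_def)
  have jx: "1 - j * x \<noteq> 0"
  proof
    assume "1 - j * x = 0"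
    then have "x^2 + 1 = 0" using j_square by Groebner_Basis.algebra
    with nz show False by simp
  qed
  have A1: "v * A1 * (1 - j * x) = R + j * v * (s - \<delta>)"
    using A_from_vee[OF c1 v_def] j_square unfolding s_def \<delta>_def by Groebner_Basis.algebra
  have "(1 - j * x) * (v * (x + A1 * s)) = (1 - j * x) * (q * R + j * v * (1 - \<delta> * q))"
    using A1 c2 j_square q[folded s_def] by Groebner_Basis.algebra
  then have "v * (x + A1 * s) = q * R + j * v * (1 - \<delta> * q)" using jx by simp
  then have "ypsilon x A1 A2 = j * \<delta> * (q * R + j * v * (1 - \<delta> * q))"
    by (simp add: ypsilon_def v_def s_def)
  then show ?thesis using xi j_square by Groebner_Basis.algebra
qed

lemma wall_reflection_level:
  assumes c: "(x, A1, A2) \<in> level_curve D E" and nz: "x^2 + 1 \<noteq> 0"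
    and A1': "A1' = ((x^2 - 1) * A1 - 2 * x * A2 + 4 * x * E) / (x^2 + 1)"
    and A2': "A2' = (- 2 * x * A1 - (x^2 - 1) * A2 + 4 * x^2 * E) / (x^2 + 1)"
  shows "(x, A1', A2') \<in> level_curve D E"
    and "A2' + D - A1' * x = A2 + D - A1 * x"
    and "vee A1' A2' * vee A1 A2 * (1 - j * x) = - (1 + j * x)"
proof -
  have 1: "(x^2 + 1) * A1' = (x^2 - 1) * A1 - 2 * x * A2 + 4 * x * E"
    "(x^2 + 1) * A2' = - 2 * x * A1 - (x^2 - 1) * A2 + 4 * x^2 * E"
    using nz by (simp_all add: A1' A2')
  have c1: "A1^2 + A2^2 - 4 * E * A2 = 1 + 2 * D * E" and c2: "x^2 + 1 = (A2 + D - A1 * x)^2"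
    using c by (auto simp: level_curve_def)
  have "(x^2 + 1) * (A2' + D - A1' * x) = (x^2 + 1) * (A2 + D - A1 * x)"
    using 1 by Groebner_Basis.algebra
  then show s: "A2' + D - A1' * x = A2 + D - A1 * x"
    using nz by (simp only: mult_cancel_left simp_thms)
  have "(x^2 + 1)^2 * (A1'^2 + A2'^2 - 4 * E * A2' - (1 + 2 * D * E)) = 0"
    using 1 c1 by Groebner_Basis.algebra
  then have "A1'^2 + A2'^2 - 4 * E * A2' = 1 + 2 * D * E" using nz by simp
  then show "(x, A1', A2') \<in> level_curve D E" using c2 unfolding s[symmetric] by (simp add: level_curve_def)
  have "(x^2 + 1) * (R * vee A1' A2') = (x - j)^2 * (A1 - j * (A2 - 2 * E))"
    using 1 j_square unfolding R_vee by Groebner_Basis.algebra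
  then have "(x^2 + 1) * (R * vee A1' A2' * vee A1 A2) = (x - j)^2 * R"
    using circle[OF c1] by Groebner_Basis.algebra
  then have "R * (x^2 + 1) * (vee A1' A2' * vee A1 A2 * (1 - j * x) + (1 + j * x)) = 0"
    using j_square by Groebner_Basis.algebra
  then show "vee A1' A2' * vee A1 A2 * (1 - j * x) = - (1 + j * x)"
    using nz R_nonzero by (simp add: add_eq_0_iff2)
qed

text \<open>The last two equations express that the line \<open>y = j R - l \<xi>\<close> meets the cubic exactly at \<open>\<xi> = 0\<close> and at
  the two points of the level curve. They follow from Vieta's formulas for the quadratic equation
  satisfied by \<open>v\<close> and \<open>v'\<close>, whose sum and product are polynomials in \<open>q\<close> because
  \<open>(1 - j x) (1 + j x) = s^2\<close>.\<close>

lemma reflection_chord: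
  assumes c: "(x, A1, A2) \<in> level_curve D E" and nz: "x^2 + 1 \<noteq> 0"
    and A1': "A1' = ((x^2 - 1) * A1 - 2 * x * A2 + 4 * x * E) / (x^2 + 1)"
    and A2': "A2' = (- 2 * x * A1 - (x^2 - 1) * A2 + 4 * x^2 * E) / (x^2 + 1)"
  obtains l where "ypsilon x A1 A2 = j * R - l * xi A1 A2"
    "ypsilon x A1' A2' = j * R - l * xi A1' A2'"
    "4 * \<delta>^2 * (D^2 + 2 * D * E - 2 - R^2) - l^2 = - (8 * R * \<delta>^3) * (xi A1 A2 + xi A1' A2')"
    "2 * \<delta> * R * (3 - D^2 - 2 * D * E) - 2 * l * (- (j * R)) = 8 * R * \<delta>^3 * xi A1 A2 * xi A1' A2'"
proof -
  note refl = wall_reflection_level[OF c nz A1' A2']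
  define s where "s = A2 + D - A1 * x"
  define v v' where "v = vee A1 A2" and "v' = vee A1' A2'"
  have jx: "1 - j * x \<noteq> 0"
  proof
    assume "1 - j * x = 0"
    then have "x^2 + 1 = 0" using j_square by Groebner_Basis.algebra
    with nz show False by simp
  qed
  define p q where "p = 1 / (1 - j * x)" and "q = s * p"
  have p: "p * (1 - j * x) = 1" using jx by (simp add: p_def)
  have q: "q * (1 - j * x) = s" using p unfolding q_def by (simp add: mult.assoc)
  have c1: "A1^2 + A2^2 - 4 * E * A2 = 1 + 2 * D * E" and c2: "x^2 + 1 = s^2"
    using c by (auto simp: level_curve_def s_def)
  have qp: "q^2 = 2 * p - 1"
    using p q_def c2 j_square by Groebner_Basis.algebra
  have v0: "v \<noteq> 0" using vee_nonzero[OF c1] by (simp add: v_def)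
  have prod: "v' * v = - (q^2)"
    using refl(3)[folded v_def v'_def] p qp by Groebner_Basis.algebra
  have "v * (R * (v + v') + 2 * j * (\<delta> * p - q)) = 0"
    using vee_quadratic[OF c1 s_def v_def] prod p q_def qp by Groebner_Basis.algebra
  with v0 have sum: "R * (v + v') = - 2 * j * (\<delta> * p - q)"
    by (simp add: add_eq_0_iff2)
  have dD: "D^2 + 2 * D * E = \<delta>^2 - R^2 + 1"
    using R_square unfolding \<delta>_def by Groebner_Basis.algebra
  have xi: "2 * \<delta> * xi A1 A2 = R - j * \<delta> * v" "2 * \<delta> * xi A1' A2' = R - j * \<delta> * v'"
    using delta0 by (simp_all add: xi_def v_def v'_def)
  show ?thesis
  proof (rule that)
    show "ypsilon x A1 A2 = j * R - 2 * j * \<delta> * (1 - \<delta> * q) * xi A1 A2"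
      by (rule ypsilon_chord[OF c _ nz]) (simp add: q s_def)
    show "ypsilon x A1' A2' = j * R - 2 * j * \<delta> * (1 - \<delta> * q) * xi A1' A2'"
      by (rule ypsilon_chord[OF refl(1) _ nz]) (simp add: q s_def refl(2))
    show "4 * \<delta>^2 * (D^2 + 2 * D * E - 2 - R^2) - (2 * j * \<delta> * (1 - \<delta> * q))^2 =
        - (8 * R * \<delta>^3) * (xi A1 A2 + xi A1' A2')"
      using xi sum qp dD j_square by Groebner_Basis.algebra
    show "2 * \<delta> * R * (3 - D^2 - 2 * D * E) - 2 * (2 * j * \<delta> * (1 - \<delta> * q)) * (- (j * R)) =
        8 * R * \<delta>^3 * xi A1 A2 * xi A1' A2'"
      using xi sum prod qp dD j_square by Groebner_Basis.algebra
  qed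
qed

lemma coordinates_inject:
  assumes c: "(x, A1, A2) \<in> level_curve D E" "(x', A1', A2') \<in> level_curve D E"
    and nz: "1 - A1^2 \<noteq> 0"
    and eq: "xi A1 A2 = xi A1' A2'" "ypsilon x A1 A2 = ypsilon x' A1' A2'"
  shows "(x, A1, A2) = (x', A1', A2')"
proof -
  have c1: "A1^2 + A2^2 - 4 * E * A2 = 1 + 2 * D * E" "A1'^2 + A2'^2 - 4 * E * A2' = 1 + 2 * D * E"
    using c by (auto simp: level_curve_def)
  have v: "vee A1 A2 = vee A1' A2'" using eq(1) delta0 j0 by (simp add: xi_def)
  have v0: "vee A1 A2 \<noteq> 0" by (rule vee_nonzero[OF c1(1)])
  have "2 * vee A1 A2 * A1 = 2 * vee A1 A2 * A1'"
    using A_from_vee(1)[OF c1(1) refl] A_from_vee(1)[OF c1(2) refl] v by simp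
  with v0 have A1: "A1' = A1" by simp
  have "2 * j * vee A1 A2 * (A2 - 2 * E) = 2 * j * vee A1 A2 * (A2' - 2 * E)"
    using A_from_vee(2)[OF c1(1) refl] A_from_vee(2)[OF c1(2) refl] v by simp
  with v0 j0 have A2: "A2' = A2" by simp
  have "x + A1 * (A2 + D - A1 * x) = x' + A1 * (A2 + D - A1 * x')"
    using eq(2) v0 delta0 j0 unfolding ypsilon_def A1 A2 by simp
  then have "(1 - A1^2) * (x - x') = 0" by Groebner_Basis.algebra
  with nz have "x = x'" by simp
  with A1 A2 show ?thesis by simp
qed

section \<open>Points in general position\<close>

text \<open>At these points the explicit formula for the Boltzmann map applies, and the chord construction on
  the cubic meets none of its degenerate cases.\<close>

definition generic :: "complex \<Rightarrow> complex \<Rightarrow> complex \<Rightarrow> bool" where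
  "generic x A1 A2 \<longleftrightarrow> (x, A1, A2) \<in> level_curve D E \<and> 1 - A1^2 \<noteq> 0 \<and>
     (- 2 * (A2 + D) * A1 / (1 - A1^2) - x)^2 + 1 \<noteq> 0 \<and> xi A1 A2 \<noteq> 0 \<and> ypsilon x A1 A2 \<noteq> 0"

text \<open>The values of \<open>v\<close> that belong to \<open>A1^2 = 1\<close>; to the vanishing of \<open>x'^2 + 1\<close> at the second wall point
  or of \<open>\<xi>\<close>; and to Kepler conics that touch the wall.\<close>

definition exceptional :: "complex set" where
  "exceptional = {v. R^2 * (v^2 + 1)^2 = 4 * v^2} \<union> {- j * \<delta> / R, R / (j * \<delta>)} \<union>
     {v. j * \<delta> * R * (1 - v^2) + (R^2 + \<delta>^2 - 1) * v = 0}"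

lemma finite_exceptional: "finite exceptional"
proof -
  have "{v. R^2 * (v^2 + 1)^2 = 4 * v^2} = {v. poly [:R^2, 0, 2 * R^2 - 4, 0, R^2:] v = 0}"
    by (auto simp: algebra_simps power2_eq_square)
  then have 1: "finite {v. R^2 * (v^2 + 1)^2 = 4 * v^2}"
    using R_nonzero by (simp add: poly_roots_finite del: poly_pCons)
  have "{v. j * \<delta> * R * (1 - v^2) + (R^2 + \<delta>^2 - 1) * v = 0} =
      {v. poly [:j * \<delta> * R, R^2 + \<delta>^2 - 1, - (j * \<delta> * R):] v = 0}"
    by (auto simp: algebra_simps power2_eq_square)
  then have 2: "finite {v. j * \<delta> * R * (1 - v^2) + (R^2 + \<delta>^2 - 1) * v = 0}"
    using R_nonzero j0 delta0 by (simp add: poly_roots_finite del: poly_pCons)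
  show ?thesis unfolding exceptional_def using 1 2 by simp
qed

lemma exceptional_if_A1_square:
  assumes "A1^2 + A2^2 - 4 * E * A2 = 1 + 2 * D * E" and "1 - A1^2 = 0"
  shows "vee A1 A2 \<in> exceptional"
proof -
  have "R^2 * ((vee A1 A2)^2 + 1)^2 = 4 * (vee A1 A2)^2"
    using A_from_vee(1)[OF assms(1) refl] assms(2) by Groebner_Basis.algebra
  then show ?thesis by (simp add: exceptional_def)
qed

lemma exceptional_if_not_generic:
  assumes c: "(x, A1, A2) \<in> level_curve D E" and ng: "\<not> generic x A1 A2"
  shows "vee A1 A2 \<in> exceptional"
proof -
  define v where "v = vee A1 A2"
  define x' where "x' = - 2 * (A2 + D) * A1 / (1 - A1^2) - x"
  have c1: "A1^2 + A2^2 - 4 * E * A2 = 1 + 2 * D * E" and c2: "x^2 + 1 = (A2 + D - A1 * x)^2"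
    using c by (auto simp: level_curve_def)
  have v0: "v \<noteq> 0" using vee_nonzero[OF c1] by (simp add: v_def)
  have a: "R \<noteq> 0" "j * \<delta> \<noteq> 0" using R_nonzero j0 delta0 by simp_all
  consider "1 - A1^2 = 0" | "1 - A1^2 \<noteq> 0" "x'^2 + 1 = 0" | "xi A1 A2 = 0" | "ypsilon x A1 A2 = 0"
    using c ng unfolding generic_def x'_def by blast
  then show ?thesis
  proof cases
    case 1
    then show ?thesis by (rule exceptional_if_A1_square[OF c1])
  next
    case 2
    have "(x', A1, A2) \<in> level_curve D E" by (rule wall_exchange_level[OF c 2(1) x'_def])
    with 2(2) have "(A2 + D - A1 * x')^2 = 0" by (auto simp: level_curve_def)
    then have "0 = A2 + D - A1 * x'" by simp
    from vee_quadratic[OF c1 this v_def]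
    have quadratic: "R * (1 - j * x') * v^2 + 2 * j * \<delta> * v - R * (1 + j * x') = 0" by simp
    have "(x' - j) * (x' + j) = 0" using 2(2) j_square by Groebner_Basis.algebra
    then consider "x' = j" | "x' = - j" by (auto simp: add_eq_0_iff2)
    then have "R * v = - j * \<delta> \<or> j * \<delta> * v = R"
    proof cases
      case 1
      have "2 * v * (R * v + j * \<delta>) = 0"
        using quadratic j_square unfolding 1 by Groebner_Basis.algebra
      with v0 show ?thesis by (simp add: add_eq_0_iff2)
    next
      case 2
      have "2 * (j * \<delta> * v - R) = 0"
        using quadratic j_square unfolding 2 by Groebner_Basis.algebra
      then show ?thesis by simp
    qed
    then have "v = - j * \<delta> / R \<or> v = R / (j * \<delta>)"
      using a by (auto simp: field_simps)
    then show ?thesis by (auto simp: exceptional_def v_def)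
  next
    case 3
    then have "j * \<delta> * v = R" using delta0 by (simp add: xi_def v_def)
    then have "v = R / (j * \<delta>)" using a by (simp add: field_simps)
    then show ?thesis by (simp add: exceptional_def v_def)
  next
    case 4
    then have "x + A1 * (A2 + D - A1 * x) = 0" using v0 a by (simp add: ypsilon_def v_def)
    then have "A1^2 + (A2 + D)^2 - 1 = 0" using c2 by Groebner_Basis.algebra
    then have "R^2 + \<delta>^2 - 1 + 2 * \<delta> * (A2 - 2 * E) = 0"
      using c1 R_square unfolding \<delta>_def by Groebner_Basis.algebra
    then have "j * \<delta> * R * (1 - v^2) + (R^2 + \<delta>^2 - 1) * v = 0"
      using A_from_vee(2)[OF c1 v_def] j_square by Groebner_Basis.algebra
    then show ?thesis by (simp add: exceptional_def v_def)
  qed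
qed

definition A1_of :: "complex \<Rightarrow> complex" where "A1_of v = R * (v^2 + 1) / (2 * v)"
definition A2_of :: "complex \<Rightarrow> complex" where "A2_of v = 2 * E + R * (v^2 - 1) / (2 * j * v)"

lemma A_of_vee:
  assumes "A1^2 + A2^2 - 4 * E * A2 = 1 + 2 * D * E"
  shows "A1_of (vee A1 A2) = A1" "A2_of (vee A1 A2) = A2"
  using A_from_vee[OF assms refl, symmetric] vee_nonzero[OF assms] j0
  by (simp_all add: A1_of_def A2_of_def)

lemma finite_exceptional_level: "finite {(x, A1, A2). (x, A1, A2) \<in> level_curve D E \<and> vee A1 A2 \<in> exceptional}"
proof -
  let ?p = "\<lambda>v. [:1 - (A2_of v + D)^2, 2 * A1_of v * (A2_of v + D), 1 - (A1_of v)^2:]"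
  have "finite {x. poly (?p v) x = 0}" for v
  proof (rule poly_roots_finite)
    show "?p v \<noteq> 0" by auto
  qed
  then have "finite (\<Union>v\<in>exceptional. (\<lambda>x. (x, A1_of v, A2_of v)) ` {x. poly (?p v) x = 0})"
    using finite_exceptional by blast
  then show ?thesis
  proof (rule finite_subset[rotated], safe)
    fix x A1 A2 assume c: "(x, A1, A2) \<in> level_curve D E" and v: "vee A1 A2 \<in> exceptional"
    have c1: "A1^2 + A2^2 - 4 * E * A2 = 1 + 2 * D * E" and c2: "x^2 + 1 = (A2 + D - A1 * x)^2"
      using c by (auto simp: level_curve_def)
    have "1 - (A2 + D)^2 + x * (2 * A1 * (A2 + D) + x * (1 - A1^2)) = 0"
      using c2 by Groebner_Basis.algebra
    then have "poly (?p (vee A1 A2)) x = 0" by (simp add: A_of_vee[OF c1])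
    then show "(x, A1, A2) \<in> (\<Union>v\<in>exceptional. (\<lambda>x. (x, A1_of v, A2_of v)) ` {x. poly (?p v) x = 0})"
      using v by (intro UN_I[of "vee A1 A2"] image_eqI[of _ _ x]) (simp_all add: A_of_vee[OF c1] del: poly_pCons)
  qed
qed

text \<open>On the affine part, a point that is not generic has one of finitely many \<open>v\<close>, which leaves two points
  at most for each. The points with \<open>w = 0\<close> satisfy \<open>A1^2 = A0^2\<close> and are covered by the same list of
  \<open>v\<close>; two points with \<open>A0 = 0\<close> remain.\<close>

lemma finite_not_generic:
  "finite (compact_curve D E - embed D ` {(x, A1, A2). generic x A1 A2})"
proof -
  let ?S1 = "embed D ` {(x, A1, A2). (x, A1, A2) \<in> level_curve D E \<and> vee A1 A2 \<in> exceptional}"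
  let ?S2 = "(\<lambda>v. hpt2 ((1, - A1_of v, 0), (A1_of v, A2_of v, 1))) ` exceptional"
  let ?S3 = "(\<lambda>k. hpt2 ((k, 0, 1), (1, k, 0))) ` {j, - j}"
  have "compact_curve D E - embed D ` {(x, A1, A2). generic x A1 A2} \<subseteq> ?S1 \<union> ?S2 \<union> ?S3"
  proof
    fix p assume p: "p \<in> compact_curve D E - embed D ` {(x, A1, A2). generic x A1 A2}"
    then obtain x s w A1 A2 A0 where z: "p = hpt2 ((x, s, w), (A1, A2, A0))"
      and on: "on_cone D E ((x, s, w), (A1, A2, A0))"
      unfolding compact_curve_def by (metis (mono_tags, lifting) DiffD1 imageE mem_Collect_eq prod.collapse)
    have c: "x^2 + w^2 = s^2" "A1^2 + A2^2 - 4 * E * A2 * A0 = (1 + 2 * D * E) * A0^2"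
      "s * A0 = A2 * w + D * w * A0 - A1 * x" "(x, s, w) \<noteq> 0" "(A1, A2, A0) \<noteq> 0"
      using on by simp_all
    consider "A0 = 0" | "A0 \<noteq> 0" "w = 0" | "A0 \<noteq> 0" "w \<noteq> 0" by blast
    then show "p \<in> ?S1 \<union> ?S2 \<union> ?S3"
    proof cases
      case 1
      have A: "A1^2 + A2^2 = 0" using c(2) 1 by simp
      have A1: "A1 \<noteq> 0" using A c(5) 1 by (auto simp: zero_prod_def)
      define k where "k = A2 / A1"
      have k: "A2 = A1 * k" using A1 by (simp add: k_def)
      have "A1^2 * ((k - j) * (k + j)) = 0" using A j_square unfolding k by Groebner_Basis.algebra
      with A1 have kj: "k = j \<or> k = - j" by (auto simp: add_eq_0_iff2)
      have "A1 * (k * w - x) = 0" using c(3) 1 k by Groebner_Basis.algebra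
      with A1 have x: "x = w * k" by (simp add: mult.commute)
      have "s^2 = 0" using c(1) kj j_square unfolding x by (auto simp: power_mult_distrib)
      then have s: "s = 0" by simp
      with x c(4) have w: "w \<noteq> 0" by (auto simp: zero_prod_def)
      have "p = hpt2 ((k, 0, 1), (1, k, 0))"
        using hpt_scale[OF w, of k 0 1] hpt_scale[OF A1, of 1 k 0]
        unfolding z hpt2.simps x s k 1 by simp
      with kj show ?thesis by blast
    next
      case 2
      define a1 a2 where "a1 = A1 / A0" and "a2 = A2 / A0"
      have A: "A1 = A0 * a1" "A2 = A0 * a2" using 2(1) by (simp_all add: a1_def a2_def)
      have "A0^2 * (a1^2 + a2^2 - 4 * E * a2 - (1 + 2 * D * E)) = 0"
        using c(2) unfolding A by Groebner_Basis.algebra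
      with 2(1) have circ: "a1^2 + a2^2 - 4 * E * a2 = 1 + 2 * D * E" by simp
      have "A0 * (s + a1 * x) = 0" using c(3) 2(2) unfolding A by (simp add: algebra_simps)
      with 2(1) have s: "s = x * - a1" by (simp add: add_eq_0_iff2 mult.commute)
      with 2(2) c(4) have x: "x \<noteq> 0" by (auto simp: zero_prod_def)
      have "x^2 * (1 - a1^2) = 0" using c(1) 2(2) unfolding s by Groebner_Basis.algebra
      with x have "1 - a1^2 = 0" by simp
      with circ have v: "vee a1 a2 \<in> exceptional" by (rule exceptional_if_A1_square)
      have "p = hpt2 ((1, - a1, 0), (a1, a2, 1))"
        using hpt_scale[OF x, of 1 "- a1" 0] hpt_scale[OF 2(1), of a1 a2 1]
        unfolding z hpt2.simps s A 2(2) by simp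
      then have "p \<in> ?S2"
        using v by (intro image_eqI[of _ _ "vee a1 a2"]) (simp_all add: A_of_vee[OF circ] del: hpt2.simps)
      then show ?thesis by blast
    next
      case 3
      with on have "p \<in> embed D ` level_curve D E" unfolding embed_image z by blast
      then obtain y where "y \<in> level_curve D E" "p = embed D y" by blast
      moreover obtain x A1 A2 where "y = (x, A1, A2)" by (cases y)
      ultimately have y: "(x, A1, A2) \<in> level_curve D E" "p = embed D (x, A1, A2)" by simp_all
      with p have "\<not> generic x A1 A2" by blast
      with y exceptional_if_not_generic show ?thesis by blast
    qed
  qed
  moreover have "finite (?S1 \<union> ?S2 \<union> ?S3)"
    using finite_exceptional finite_exceptional_level by blast
  ultimately show ?thesis by (rule finite_subset)
qed

end

section \<open>Points of the compactified curve are not isolated\<close>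

text \<open>The value of a quadratic polynomial at \<open>t0\<close>, divided by the leading coefficient, is the product of
  the distances to the roots; the nearer root satisfies the estimate.\<close>

lemma quadratic_root_near:
  fixes \<alpha> \<beta> \<gamma> t0 :: complex
  assumes "\<alpha> \<noteq> 0"
  obtains t where "\<alpha> * t^2 + \<beta> * t + \<gamma> = 0"
    "(norm (t - t0))^2 \<le> norm (\<alpha> * t0^2 + \<beta> * t0 + \<gamma>) / norm \<alpha>"
proof -
  define d where "d = csqrt (\<beta>^2 - 4 * \<alpha> * \<gamma>)"
  have d: "d^2 = \<beta>^2 - 4 * \<alpha> * \<gamma>" by (simp add: d_def)
  define r1 r2 where "r1 = (- \<beta> + d) / (2 * \<alpha>)" and "r2 = (- \<beta> - d) / (2 * \<alpha>)"
  have r: "2 * \<alpha> * r1 = - \<beta> + d" "2 * \<alpha> * r2 = - \<beta> - d"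
    using assms by (simp_all add: r1_def r2_def)
  have factor: "\<alpha> * t^2 + \<beta> * t + \<gamma> = \<alpha> * (t - r1) * (t - r2)" for t
  proof -
    have "4 * \<alpha> * (\<alpha> * t^2 + \<beta> * t + \<gamma>) = 4 * \<alpha> * (\<alpha> * (t - r1) * (t - r2))"
      using r d by Groebner_Basis.algebra
    with assms show ?thesis by simp
  qed
  have prod: "norm (r1 - t0) * norm (r2 - t0) = norm (\<alpha> * t0^2 + \<beta> * t0 + \<gamma>) / norm \<alpha>"
    using assms unfolding factor by (simp add: norm_mult norm_minus_commute)
  show ?thesis
  proof (cases "norm (r1 - t0) \<le> norm (r2 - t0)")
    case True
    show ?thesis
    proof (rule that[of r1])
      show "(norm (r1 - t0))^2 \<le> norm (\<alpha> * t0^2 + \<beta> * t0 + \<gamma>) / norm \<alpha>"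
        using mult_left_mono[OF True, of "norm (r1 - t0)"] prod by (simp add: power2_eq_square)
    qed (simp add: factor)
  next
    case False
    show ?thesis
    proof (rule that[of r2])
      show "(norm (r2 - t0))^2 \<le> norm (\<alpha> * t0^2 + \<beta> * t0 + \<gamma>) / norm \<alpha>"
        using mult_right_mono[of "norm (r2 - t0)" "norm (r1 - t0)" "norm (r2 - t0)"] False prod
        by (simp add: power2_eq_square)
    qed (simp add: factor)
  qed
qed

context kepler_wall
begin

text \<open>The homogeneous version of the parametrization of the circle by \<open>v\<close>; it misses only the point at
  infinity \<open>(1 : - j : 0)\<close>, where \<open>v = \<infinity>\<close>.\<close>

definition avec :: "complex \<Rightarrow> complex \<times> complex \<times> complex" where
  "avec v = (R * (v^2 + 1) / 2, 2 * E * v - j * R * (v^2 - 1) / 2, v)"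

lemma avec_on_conic:
  "avec v = (A1, A2, A0) \<Longrightarrow> A1^2 + A2^2 - 4 * E * A2 * A0 = (1 + 2 * D * E) * A0^2"
proof -
  assume "avec v = (A1, A2, A0)"
  then have "2 * A1 = R * (v^2 + 1)" "2 * A2 = 4 * E * v - j * R * (v^2 - 1)" "A0 = v"
    by (auto simp: avec_def field_simps)
  then have "4 * (A1^2 + A2^2 - 4 * E * A2 * A0) = 4 * ((1 + 2 * D * E) * A0^2)"
    using R_square j_square by Groebner_Basis.algebra
  then show ?thesis by (simp only: mult_cancel_left) simp
qed

lemma avec_inject:
  assumes "hpt (avec v) = hpt (avec v')"
  shows "v = v'"
proof -
  obtain k where k: "avec v' = scale3 k (avec v)" using hpt_eqD3[OF assms] by blast
  have R: "fst (avec w) - j * (fst (snd (avec w)) - 2 * E * snd (snd (avec w))) = R" for w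
  proof -
    have "R * (w^2 + 1) / 2 + j * j * R * (w^2 - 1) / 2 = R"
      using j_square by (simp add: power2_eq_square field_simps)
    then show ?thesis by (simp add: avec_def algebra_simps)
  qed
  have "R = k * R"
    using R[of v'] unfolding k by (subst R[of v, symmetric]) (simp add: avec_def algebra_simps)
  then have "k = 1" using R_nonzero by simp
  with k show ?thesis by (simp add: avec_def)
qed

lemma conic_avec:
  assumes "A1^2 + A2^2 - 4 * E * A2 * A0 = (1 + 2 * D * E) * A0^2"
    and nz: "A1 - j * (A2 - 2 * E * A0) \<noteq> 0"
  obtains k v where "k \<noteq> 0" "(A1, A2, A0) = scale3 k (avec v)"
proof -
  define k where "k = (A1 - j * (A2 - 2 * E * A0)) / R"
  have k: "R * k = A1 - j * (A2 - 2 * E * A0)" "k \<noteq> 0" using R_nonzero nz by (simp_all add: k_def)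
  define v where "v = A0 / k"
  have v: "k * v = A0" using k(2) by (simp add: v_def)
  have "(R * k) * (A1 + j * (A2 - 2 * E * A0)) = R^2 * (k * v)^2"
    using assms(1) R_square j_square unfolding k(1) v by Groebner_Basis.algebra
  then have "R * k * (A1 + j * (A2 - 2 * E * A0) - R * k * v^2) = 0" by Groebner_Basis.algebra
  with k(2) R_nonzero have w: "A1 + j * (A2 - 2 * E * A0) = R * k * v^2" by simp
  have "2 * A1 = k * R * (v^2 + 1)" using k(1) w by Groebner_Basis.algebra
  moreover have "2 * A2 = 4 * E * k * v - j * k * R * (v^2 - 1)"
    using k(1) w v j_square by Groebner_Basis.algebra
  ultimately have "A1 = k * (R * (v^2 + 1) / 2)" "A2 = k * (2 * E * v - j * R * (v^2 - 1) / 2)"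
    by (simp_all add: field_simps)
  with v have "(A1, A2, A0) = scale3 k (avec v)" by (simp add: avec_def)
  with k(2) show ?thesis by (rule that)
qed

text \<open>Move \<open>v\<close> and follow the point on the conic \<open>x^2 + w^2 = s^2\<close>: in a rational parameter \<open>t\<close> of this conic
  it is a root of a quadratic polynomial with coefficients continuous in \<open>v\<close>. The parametrization
  misses one point, \<open>(- \<sigma> : 1 : 0)\<close>, and the sign \<open>\<sigma>\<close> is chosen so that this point is not on the line
  given by \<open>v0\<close>; then the leading coefficient of the quadratic is nonzero near \<open>v0\<close>.\<close>

lemma curve_point_limit_aux:
  assumes on: "on_cone D E ((x, s, w), (A1, A2, A0))" and nz: "A1 - j * (A2 - 2 * E * A0) \<noteq> 0"
  obtains zs where "zs \<longlonglongrightarrow> ((x, s, w), (A1, A2, A0))" "\<And>k. on_cone D E (zs k)" "inj (\<lambda>k. hpt2 (zs k))"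
proof -
  have c: "x^2 + w^2 = s^2" "A1^2 + A2^2 - 4 * E * A2 * A0 = (1 + 2 * D * E) * A0^2"
    "s * A0 = A2 * w + D * w * A0 - A1 * x" "(x, s, w) \<noteq> 0"
    using on by (simp_all add: zero_prod_def)
  obtain m v0 where m: "m \<noteq> 0" and a: "(A1, A2, A0) = scale3 m (avec v0)"
    using conic_avec[OF c(2) nz] .
  have a': "A1 = m * (R * (v0^2 + 1) / 2)" "A2 = m * (2 * E * v0 - j * R * (v0^2 - 1) / 2)" "A0 = m * v0"
    using a by (simp_all add: avec_def)
  have "\<exists>\<sigma>. \<sigma>^2 = 1 \<and> A0 - \<sigma> * A1 \<noteq> 0"
  proof (rule ccontr)
    assume "\<not> ?thesis"
    then have "A0 - 1 * A1 = 0" "A0 - (-1) * A1 = 0" by (metis one_power2 power2_minus)+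
    then have "A0 = 0" "A1 = 0" by (simp_all add: equation_minus_iff)
    with c(2) nz show False by simp
  qed
  then obtain \<sigma> where \<sigma>: "\<sigma>^2 = 1" "A0 - \<sigma> * A1 \<noteq> 0" by blast
  have sx: "s + \<sigma> * x \<noteq> 0"
  proof
    assume 0: "s + \<sigma> * x = 0"
    then have "w^2 = 0" using c(1) \<sigma>(1) by Groebner_Basis.algebra
    then have w: "w = 0" by simp
    with 0 c(3) have "\<sigma> * x * (A0 - \<sigma> * A1) = 0" using \<sigma>(1) by Groebner_Basis.algebra
    with \<sigma> have "x = 0" by auto
    with w 0 c(4) show False by (simp add: zero_prod_def)
  qed
  define l t0 where "l = (s + \<sigma> * x) / 2" and "t0 = w / (2 * l)"
  have l2: "l \<noteq> 0" "2 * l = s + \<sigma> * x" using sx by (simp_all add: l_def)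
  have "2 * l * t0 = w" using l2(1) by (simp add: t0_def)
  note l = l2 this
  have "2 * l * (l * (2 * t0^2) - (s - \<sigma> * x)) = 0"
    using c(1) \<sigma>(1) l(2,3) by Groebner_Basis.algebra
  with l(1) have l4: "l * (2 * t0^2) = s - \<sigma> * x" by simp
  have u: "x = l * (\<sigma> * (1 - t0^2))" "s = l * (1 + t0^2)" "w = l * (2 * t0)"
  proof -
    have "2 * x = 2 * (l * (\<sigma> * (1 - t0^2)))" "2 * s = 2 * (l * (1 + t0^2))"
      using l l4 \<sigma>(1) by Groebner_Basis.algebra+
    then show "x = l * (\<sigma> * (1 - t0^2))" "s = l * (1 + t0^2)" by simp_all
    show "w = l * (2 * t0)" using l(3) by (simp add: mult_ac)
  qed
  define \<alpha> \<beta> \<gamma> where "\<alpha> v = v - \<sigma> * (R * (v^2 + 1) / 2)"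
    and "\<beta> v = - 2 * ((2 * E * v - j * R * (v^2 - 1) / 2) + D * v)"
    and "\<gamma> v = v + \<sigma> * (R * (v^2 + 1) / 2)" for v
  have root0: "\<alpha> v0 * t0^2 + \<beta> v0 * t0 + \<gamma> v0 = 0"
  proof -
    define h1 h2 where "h1 = R * (v0^2 + 1) / 2" and "h2 = 2 * E * v0 - j * R * (v0^2 - 1) / 2"
    have "\<alpha> v0 = v0 - \<sigma> * h1" "\<beta> v0 = - 2 * (h2 + D * v0)" "\<gamma> v0 = v0 + \<sigma> * h1"
      "A1 = m * h1" "A2 = m * h2"
      by (simp_all add: \<alpha>_def \<beta>_def \<gamma>_def a' h1_def h2_def)
    then have "l * m * (\<alpha> v0 * t0^2 + \<beta> v0 * t0 + \<gamma> v0) = s * A0 - (A2 * w + D * w * A0 - A1 * x)"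
      using a'(3) u by Groebner_Basis.algebra
    with c(3) l(1) m show ?thesis by simp
  qed
  have \<alpha>0: "\<alpha> v0 \<noteq> 0"
  proof
    assume "\<alpha> v0 = 0"
    then have "m * \<alpha> v0 = 0" by simp
    then have "A0 - \<sigma> * A1 = 0" unfolding \<alpha>_def a' by (simp add: algebra_simps)
    with \<sigma> show False by simp
  qed
  have cont: "isCont \<alpha> v0" "isCont \<beta> v0" "isCont \<gamma> v0"
    unfolding \<alpha>_def \<beta>_def \<gamma>_def by (intro continuous_intros; simp)+
  have "\<forall>\<^sub>F v in nhds v0. \<alpha> v \<noteq> 0"
    using cont(1) \<alpha>0 by (intro tendsto_imp_eventually_ne) (simp_all add: isCont_def tendsto_at_iff_tendsto_nhds)
  then obtain e where e: "e > 0" "\<And>v. dist v v0 < e \<Longrightarrow> \<alpha> v \<noteq> 0"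
    unfolding eventually_nhds_metric by blast
  define vs where "vs k = v0 + of_real (e / 2) * of_real (inverse (real (Suc k)))" for k
  have vs_lim: "vs \<longlonglongrightarrow> v0"
  proof -
    have "(\<lambda>k. v0 + of_real (e / 2) * of_real (inverse (real (Suc k)))) \<longlonglongrightarrow> v0 + of_real (e / 2) * of_real 0"
      by (intro tendsto_intros LIMSEQ_inverse_real_of_nat)
    then show ?thesis unfolding vs_def by simp
  qed
  have \<alpha>vs: "\<alpha> (vs k) \<noteq> 0" for k
  proof (rule e(2))
    have "dist (vs k) v0 = e / 2 * inverse (real (Suc k))"
      using e(1) by (simp add: vs_def dist_norm norm_mult norm_divide norm_inverse del: of_nat_Suc)
    also have "\<dots> \<le> e / 2 * 1"
      using e(1) by (intro mult_left_mono) (simp_all add: inverse_eq_divide)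
    finally show "dist (vs k) v0 < e" using e(1) by simp
  qed
  have inj_vs: "inj vs"
    using e(1) by (auto simp: inj_def vs_def)
  have "\<exists>t. \<alpha> (vs k) * t^2 + \<beta> (vs k) * t + \<gamma> (vs k) = 0 \<and>
      (norm (t - t0))^2 \<le> norm (\<alpha> (vs k) * t0^2 + \<beta> (vs k) * t0 + \<gamma> (vs k)) / norm (\<alpha> (vs k))" for k
    using quadratic_root_near[OF \<alpha>vs[of k]] by metis
  then obtain ts where ts: "\<And>k. \<alpha> (vs k) * (ts k)^2 + \<beta> (vs k) * ts k + \<gamma> (vs k) = 0"
    "\<And>k. (norm (ts k - t0))^2 \<le> norm (\<alpha> (vs k) * t0^2 + \<beta> (vs k) * t0 + \<gamma> (vs k)) / norm (\<alpha> (vs k))"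
    by metis
  have "(\<lambda>k. norm (\<alpha> (vs k) * t0^2 + \<beta> (vs k) * t0 + \<gamma> (vs k)) / norm (\<alpha> (vs k))) \<longlonglongrightarrow>
      norm (\<alpha> v0 * t0^2 + \<beta> v0 * t0 + \<gamma> v0) / norm (\<alpha> v0)"
    using \<alpha>0 by (intro tendsto_intros isCont_tendsto_compose[OF _ vs_lim] cont) simp
  then have bound: "(\<lambda>k. norm (\<alpha> (vs k) * t0^2 + \<beta> (vs k) * t0 + \<gamma> (vs k)) / norm (\<alpha> (vs k))) \<longlonglongrightarrow> 0"
    unfolding root0 by simp
  have "(\<lambda>k. (norm (ts k - t0))^2) \<longlonglongrightarrow> 0"
    by (rule tendsto_sandwich[OF _ _ tendsto_const bound]) (simp_all add: ts(2))
  then have "(\<lambda>k. sqrt ((norm (ts k - t0))^2)) \<longlonglongrightarrow> sqrt 0" by (rule tendsto_real_sqrt)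
  then have ts_lim: "ts \<longlonglongrightarrow> t0"
    by (simp add: tendsto_norm_zero_iff LIM_zero_iff)
  define zs where "zs k = ((l * (\<sigma> * (1 - (ts k)^2)), l * (1 + (ts k)^2), l * (2 * ts k)), scale3 m (avec (vs k)))" for k
  show ?thesis
  proof (rule that)
    show "zs \<longlonglongrightarrow> ((x, s, w), (A1, A2, A0))"
      unfolding zs_def[abs_def] u a avec_def scale3.simps by (intro tendsto_intros ts_lim vs_lim) simp_all
    show "inj (\<lambda>k. hpt2 (zs k))"
    proof (rule injI)
      fix k k' assume "hpt2 (zs k) = hpt2 (zs k')"
      then have "hpt (avec (vs k)) = hpt (avec (vs k'))"
        unfolding zs_def hpt2.simps hpt_scale3[OF m] by simp
      then have "vs k = vs k'" by (rule avec_inject)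
      with inj_vs show "k = k'" by (simp add: inj_def)
    qed
    fix k
    define t v where "t = ts k" and "v = vs k"
    obtain B1 B2 B0 where B: "avec v = (B1, B2, B0)" by (cases "avec v")
    then have B': "B1 = R * (v^2 + 1) / 2" "B2 = 2 * E * v - j * R * (v^2 - 1) / 2" "B0 = v"
      unfolding avec_def by auto
    have "\<alpha> v = B0 - \<sigma> * B1" "\<beta> v = - 2 * (B2 + D * B0)" "\<gamma> v = B0 + \<sigma> * B1"
      unfolding \<alpha>_def \<beta>_def \<gamma>_def B' by simp_all
    with ts(1)[of k] have line: "(B0 - \<sigma> * B1) * t^2 + - 2 * (B2 + D * B0) * t + (B0 + \<sigma> * B1) = 0"
      by (simp only: t_def v_def)
    have "B1 \<noteq> 0 \<or> B2 \<noteq> 0 \<or> B0 \<noteq> 0"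
    proof (cases "v = 0")
      case True
      with R_nonzero show ?thesis by (simp add: B')
    qed (simp add: B')
    moreover have "l * (1 + t^2) \<noteq> 0 \<or> l * (2 * t) \<noteq> 0"
      using l(1) by (cases "t = 0") simp_all
    moreover have "(l * (\<sigma> * (1 - t^2)))^2 + (l * (2 * t))^2 = (l * (1 + t^2))^2"
      using \<sigma>(1) by Groebner_Basis.algebra
    moreover have "(m * B1)^2 + (m * B2)^2 - 4 * E * (m * B2) * (m * B0) = (1 + 2 * D * E) * (m * B0)^2"
      using avec_on_conic[OF B] by Groebner_Basis.algebra
    moreover have "(l * (1 + t^2)) * (m * B0) = (m * B2) * (l * (2 * t)) + D * (l * (2 * t)) * (m * B0)
        - (m * B1) * (l * (\<sigma> * (1 - t^2)))"
      using line by Groebner_Basis.algebra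
    ultimately show "on_cone D E (zs k)"
      unfolding zs_def t_def[symmetric] v_def[symmetric] B scale3.simps on_cone.simps
      using m by (auto simp: zero_prod_def)
  qed
qed

end

text \<open>The one point of the circle that is missing in the parametrization for \<open>j\<close> is reached with the one
  for \<open>- j\<close>.\<close>

lemma (in kepler_wall) curve_point_limit:
  assumes on: "on_cone D E z"
  obtains zs where "zs \<longlonglongrightarrow> z" "\<And>k. on_cone D E (zs k)" "inj (\<lambda>k. hpt2 (zs k))"
proof -
  obtain x s w A1 A2 A0 where z: "z = ((x, s, w), (A1, A2, A0))" by (metis prod.collapse)
  show ?thesis
  proof (cases "A1 - j * (A2 - 2 * E * A0) = 0")
    case False
    then show ?thesis using curve_point_limit_aux[of x s w A1 A2 A0] on that unfolding z by blast
  next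
    case True
    have c: "A1^2 + A2^2 - 4 * E * A2 * A0 = (1 + 2 * D * E) * A0^2" "(A1, A2, A0) \<noteq> 0"
      using on by (simp_all add: z zero_prod_def)
    interpret conj: kepler_wall D E R "- j"
      using R_square R_nonzero delta_nonzero j_square by unfold_locales simp_all
    have "A1 - (- j) * (A2 - 2 * E * A0) \<noteq> 0"
    proof
      assume 1: "A1 - (- j) * (A2 - 2 * E * A0) = 0"
      have "A1 = 0" "A2 = 2 * E * A0" using 1 True j0 by (auto simp: add_eq_0_iff2)
      moreover from this have "R^2 * A0^2 = 0" using c(1) R_square by Groebner_Basis.algebra
      ultimately show False using R_nonzero c(2) by (simp add: zero_prod_def)
    qed
    then show ?thesis using conj.curve_point_limit_aux[of x s w A1 A2 A0] on that unfolding z by blast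
  qed
qed

section \<open>Continuity of the extended maps\<close>

lemma on_cone_representative:
  assumes "hpt2 w \<in> compact_curve D E"
  shows "on_cone D E w"
proof -
  obtain u a where w: "w = (u, a)" by (cases w)
  from assms obtain u0 a0 where z: "on_cone D E (u0, a0)" "hpt2 (u, a) = hpt2 (u0, a0)"
    unfolding compact_curve_def w by (metis (mono_tags, lifting) imageE mem_Collect_eq prod.collapse)
  from z(2)[symmetric] obtain k l where kl: "k \<noteq> 0" "l \<noteq> 0" "u = scale3 k u0" "a = scale3 l a0"
    by (rule hpt2_eqD)
  obtain x s t A1 A2 A0 where u0: "u0 = (x, s, t)" and a0: "a0 = (A1, A2, A0)"
    by (cases u0; cases a0)
  have dot: "dot3 (scale3 l n) (scale3 k v) = l * k * dot3 n v" for n v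
    by (cases n; cases v) (simp add: algebra_simps)
  show ?thesis
    using z(1) kl(1,2) unfolding w kl(3,4) on_cone_iff1
    by (simp add: scale3_eq_0 quad_scale3 line_scale3 dot del: quad.simps dot3.simps scale3.simps)
qed

text \<open>Equality of points of the projective plane as a closed condition on coordinate vectors.\<close>

definition cross3 :: "complex \<times> complex \<times> complex \<Rightarrow> complex \<times> complex \<times> complex \<Rightarrow>
    complex \<times> complex \<times> complex" where
  "cross3 u v = (fst u * fst (snd v) - fst (snd u) * fst v, fst u * snd (snd v) - snd (snd u) * fst v,
     fst (snd u) * snd (snd v) - snd (snd u) * fst (snd v))"

lemma hpt_eq_iff_cross3:
  assumes "u \<noteq> 0" "v \<noteq> 0"
  shows "hpt u = hpt v \<longleftrightarrow> cross3 u v = 0"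
proof
  assume "hpt u = hpt v"
  then obtain k where "v = scale3 k u" using hpt_eqD3 by blast
  then show "cross3 u v = 0" by (cases u) (simp add: cross3_def zero_prod_def)
next
  assume *: "cross3 u v = 0"
  obtain a b c a' b' c' where uv: "u = (a, b, c)" "v = (a', b', c')" by (cases u; cases v)
  show "hpt u = hpt v"
    using assms * unfolding uv by (intro hpt_eqI) (simp_all add: cross3_def zero_prod_def)
qed

lemma tendsto_cross3:
  assumes "(f \<longlongrightarrow> a) F" "(g \<longlongrightarrow> b) F"
  shows "((\<lambda>x. cross3 (f x) (g x)) \<longlongrightarrow> cross3 a b) F"
  unfolding cross3_def by (intro tendsto_intros assms)

text \<open>What remains of a regular map when polynomials are replaced by continuous functions. It is all that
  passing to limits requires, and it is stable under composition.\<close>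

definition locally_liftable :: "complex \<Rightarrow> complex \<Rightarrow> (ppt2 \<Rightarrow> ppt2) \<Rightarrow> bool" where
  "locally_liftable D E F \<longleftrightarrow> F \<in> compact_curve D E \<rightarrow> compact_curve D E \<and>
     (\<forall>z. on_cone D E z \<longrightarrow> (\<exists>P. isCont P z \<and> fst (P z) \<noteq> 0 \<and> snd (P z) \<noteq> 0 \<and>
        (\<forall>\<^sub>F z' in nhds z. on_cone D E z' \<longrightarrow> F (hpt2 z') = hpt2 (P z'))))"

lemma isCont_polynomial_fn: "polynomial_fn f \<Longrightarrow> isCont f z"
  by (induction rule: polynomial_fn.induct) (auto intro!: continuous_intros)

lemma isCont_polynomial_triple:
  assumes "polynomial_triple P"
  shows "isCont P z"
proof -
  have "isCont (\<lambda>z. (fst (P z), fst (snd (P z)), snd (snd (P z)))) z"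
    using assms unfolding polynomial_triple_def
    by (intro continuous_Pair isCont_polynomial_fn) auto
  then show ?thesis by simp
qed

lemma locally_liftable_if_regular_map:
  assumes "regular_map D E F"
  shows "locally_liftable D E F"
  unfolding locally_liftable_def
proof (intro conjI allI impI)
  show "F \<in> compact_curve D E \<rightarrow> compact_curve D E" using assms by (simp add: regular_map_def)
  fix z assume "on_cone D E z"
  with assms obtain P Q where PQ: "polynomial_triple P" "polynomial_triple Q" "P z \<noteq> 0" "Q z \<noteq> 0"
    and F: "\<And>z'. on_cone D E z' \<and> P z' \<noteq> 0 \<and> Q z' \<noteq> 0 \<Longrightarrow> F (hpt2 z') = hpt2 (P z', Q z')"
    unfolding regular_map_def by blast
  have ev: "\<forall>\<^sub>F z' in nhds z. P' z' \<noteq> 0" if "polynomial_triple P'" "P' z \<noteq> 0" for P'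
    using isCont_polynomial_triple[OF that(1), of z] that(2)
    by (intro tendsto_imp_eventually_ne) (simp_all add: isCont_def tendsto_at_iff_tendsto_nhds)
  have "isCont (\<lambda>z. (P z, Q z)) z"
    by (intro continuous_Pair isCont_polynomial_triple PQ)
  moreover have "\<forall>\<^sub>F z' in nhds z. on_cone D E z' \<longrightarrow> F (hpt2 z') = hpt2 (P z', Q z')"
    using ev[OF PQ(1,3)] ev[OF PQ(2,4)] by eventually_elim (use F in blast)
  ultimately show "\<exists>P. isCont P z \<and> fst (P z) \<noteq> 0 \<and> snd (P z) \<noteq> 0 \<and>
      (\<forall>\<^sub>F z' in nhds z. on_cone D E z' \<longrightarrow> F (hpt2 z') = hpt2 (P z'))"
    using PQ(3,4) by (intro exI[of _ "\<lambda>z. (P z, Q z)"]) simp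
qed

lemma locally_liftable_comp:
  assumes F: "locally_liftable D E F" and G: "locally_liftable D E G"
  shows "locally_liftable D E (G \<circ> F)"
  unfolding locally_liftable_def
proof (intro conjI allI impI)
  show "G \<circ> F \<in> compact_curve D E \<rightarrow> compact_curve D E"
    using F G by (auto simp: locally_liftable_def)
  fix z assume z: "on_cone D E z"
  with F obtain P where P: "isCont P z" "fst (P z) \<noteq> 0" "snd (P z) \<noteq> 0"
    and FP: "\<forall>\<^sub>F z' in nhds z. on_cone D E z' \<longrightarrow> F (hpt2 z') = hpt2 (P z')"
    unfolding locally_liftable_def by blast
  have in_curve: "F (hpt2 z') \<in> compact_curve D E" if "on_cone D E z'" for z'
    using F that unfolding locally_liftable_def compact_curve_def by blast
  have "on_cone D E (P z)"
    using eventually_nhds_x_imp_x[OF FP] z in_curve[OF z] by (simp add: on_cone_representative)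
  with G obtain Q where Q: "isCont Q (P z)" "fst (Q (P z)) \<noteq> 0" "snd (Q (P z)) \<noteq> 0"
    and GQ: "\<forall>\<^sub>F w in nhds (P z). on_cone D E w \<longrightarrow> G (hpt2 w) = hpt2 (Q w)"
    unfolding locally_liftable_def by blast
  have "filterlim P (nhds (P z)) (nhds z)"
    using P(1) by (simp add: isCont_def tendsto_at_iff_tendsto_nhds)
  with GQ have "\<forall>\<^sub>F z' in nhds z. on_cone D E (P z') \<longrightarrow> G (hpt2 (P z')) = hpt2 (Q (P z'))"
    by (rule eventually_compose_filterlim)
  with FP have "\<forall>\<^sub>F z' in nhds z. on_cone D E z' \<longrightarrow> (G \<circ> F) (hpt2 z') = hpt2 (Q (P z'))"
    by eventually_elim (metis comp_apply in_curve on_cone_representative)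
  then show "\<exists>P. isCont P z \<and> fst (P z) \<noteq> 0 \<and> snd (P z) \<noteq> 0 \<and>
      (\<forall>\<^sub>F z' in nhds z. on_cone D E z' \<longrightarrow> (G \<circ> F) (hpt2 z') = hpt2 (P z'))"
    using P(1) Q by (intro exI[of _ "\<lambda>z. Q (P z)"]) (simp add: isCont_o2)
qed

lemma locally_liftable_funpow:
  assumes "locally_liftable D E F"
  shows "locally_liftable D E (F ^^ n)"
proof (induction n)
  case 0
  have "locally_liftable D E id"
    unfolding locally_liftable_def
    using on_cone_nonzero by (fastforce intro!: exI[of _ "\<lambda>z. z"])
  then show ?case by (simp add: id_def)
next
  case (Suc n)
  have "F ^^ Suc n = F \<circ> F ^^ n" by simp
  then show ?case using locally_liftable_comp[OF Suc assms] by (simp only:)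
qed

text \<open>A local lift \<open>P\<close> of the map satisfies \<open>cross3 (P z) z = 0\<close> in both factors at fixed points, and this
  condition passes to the limit.\<close>

lemma liftable_fixes_limit:
  assumes F: "locally_liftable D E F" and z: "on_cone D E z"
    and zs: "zs \<longlonglongrightarrow> z" "\<And>k. on_cone D E (zs k)"
    and fixed: "\<forall>\<^sub>F k in sequentially. F (hpt2 (zs k)) = hpt2 (zs k)"
  shows "F (hpt2 z) = hpt2 z"
proof -
  obtain P where P: "isCont P z" "fst (P z) \<noteq> 0" "snd (P z) \<noteq> 0"
    and FP: "\<forall>\<^sub>F z' in nhds z. on_cone D E z' \<longrightarrow> F (hpt2 z') = hpt2 (P z')"
    using F z unfolding locally_liftable_def by blast
  have lim: "(\<lambda>k. P (zs k)) \<longlonglongrightarrow> P z"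
    using P(1) zs(1) by (rule isCont_tendsto_compose)
  have ne: "\<forall>\<^sub>F k in sequentially. fst (P (zs k)) \<noteq> 0" "\<forall>\<^sub>F k in sequentially. snd (P (zs k)) \<noteq> 0"
    by (rule tendsto_imp_eventually_ne[OF tendsto_fst[OF lim] P(2)]
        tendsto_imp_eventually_ne[OF tendsto_snd[OF lim] P(3)])+
  have FP': "\<forall>\<^sub>F k in sequentially. on_cone D E (zs k) \<longrightarrow> F (hpt2 (zs k)) = hpt2 (P (zs k))"
    using FP zs(1) by (rule eventually_compose_filterlim)
  have "\<forall>\<^sub>F k in sequentially. cross3 (fst (P (zs k))) (fst (zs k)) = 0 \<and>
      cross3 (snd (P (zs k))) (snd (zs k)) = 0"
    using ne fixed FP'
  proof eventually_elim
    case (elim k)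
    then have "hpt2 (P (zs k)) = hpt2 (zs k)" using zs(2) by simp
    then have "hpt (fst (P (zs k))) = hpt (fst (zs k))" "hpt (snd (P (zs k))) = hpt (snd (zs k))"
      unfolding hpt2_conv by simp_all
    with elim(1,2) on_cone_nonzero[OF zs(2)] show ?case by (simp add: hpt_eq_iff_cross3)
  qed
  then have ev: "\<forall>\<^sub>F k in sequentially. cross3 (fst (P (zs k))) (fst (zs k)) = 0"
    "\<forall>\<^sub>F k in sequentially. cross3 (snd (P (zs k))) (snd (zs k)) = 0"
    by (eventually_elim, simp)+
  have "(\<lambda>k. cross3 (fst (P (zs k))) (fst (zs k))) \<longlonglongrightarrow> 0"
    "(\<lambda>k. cross3 (snd (P (zs k))) (snd (zs k))) \<longlonglongrightarrow> 0"
    using ev by (simp_all add: tendsto_eventually)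
  moreover have "(\<lambda>k. cross3 (fst (P (zs k))) (fst (zs k))) \<longlonglongrightarrow> cross3 (fst (P z)) (fst z)"
    "(\<lambda>k. cross3 (snd (P (zs k))) (snd (zs k))) \<longlonglongrightarrow> cross3 (snd (P z)) (snd z)"
    by (intro tendsto_cross3 tendsto_fst tendsto_snd lim zs(1))+
  ultimately have "cross3 (fst (P z)) (fst z) = 0" "cross3 (snd (P z)) (snd z) = 0"
    using LIMSEQ_unique by blast+
  then have "hpt2 (P z) = hpt2 z"
    using P(2,3) on_cone_nonzero[OF z] by (simp add: hpt2_conv hpt_eq_iff_cross3)
  moreover have "F (hpt2 z) = hpt2 (P z)" using eventually_nhds_x_imp_x[OF FP] z by simp
  ultimately show ?thesis by simp
qed

section \<open>The expansion of the square root\<close>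

lemma has_fps_expansion_unique_complex:
  fixes f :: "complex \<Rightarrow> complex"
  assumes "f has_fps_expansion F" "f has_fps_expansion G"
  shows "F = G"
  using assms by (intro fps_ext) (simp add: fps_nth_fps_expansion)

lemma (in kepler_wall) sqrt_expansion:
  assumes g: "\<forall>\<^sub>F \<xi> in nhds 0. (g \<xi>)^2 =
       (2 * (D + 2 * E) * \<xi> - R) *
       (4 * R * (D + 2 * E)^2 * \<xi>^2 + 2 * (D + 2 * E) * (D^2 + 2 * D * E - 2) * \<xi> + R)"
    and B: "g has_fps_expansion B"
  shows "B^2 = fps_of_poly [:- (R^2), 2 * \<delta> * R * (3 - D^2 - 2 * D * E),
    4 * \<delta>^2 * (D^2 + 2 * D * E - 2 - R^2), 8 * R * \<delta>^3:]"
proof -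
  let ?f = "\<lambda>\<xi>. (2 * (D + 2 * E) * \<xi> - R) *
       (4 * R * (D + 2 * E)^2 * \<xi>^2 + 2 * (D + 2 * E) * (D^2 + 2 * D * E - 2) * \<xi> + R)"
  let ?F = "(fps_const (2 * \<delta>) * fps_X - fps_const R) *
    (fps_const (4 * R * \<delta>^2) * fps_X^2 + fps_const (2 * \<delta> * (D^2 + 2 * D * E - 2)) * fps_X + fps_const R)"
  have "(\<lambda>\<xi>. g \<xi> * g \<xi>) has_fps_expansion B * B" by (intro has_fps_expansion_mult B)
  then have "fps_conv_radius (B * B) > 0" "\<forall>\<^sub>F \<xi> in nhds 0. eval_fps (B * B) \<xi> = g \<xi> * g \<xi>"
    by (auto simp: has_fps_expansion_def)
  moreover from this(2) g have "\<forall>\<^sub>F \<xi> in nhds 0. eval_fps (B * B) \<xi> = ?f \<xi>"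
    by eventually_elim (simp add: power2_eq_square)
  ultimately have "?f has_fps_expansion B * B" by (simp add: has_fps_expansion_def)
  moreover have "?f has_fps_expansion ?F"
    unfolding \<delta>_def by (intro fps_expansion_intros)
  ultimately have "B * B = ?F" by (rule has_fps_expansion_unique_complex)
  also have "?F = fps_of_poly [:- R, 2 * \<delta>:] *
      fps_of_poly [:R, 2 * \<delta> * (D^2 + 2 * D * E - 2), 4 * R * \<delta>^2:]"
    by (rule arg_cong2[of _ _ _ _ "(*)"]; rule fps_ext)
      (auto simp: fps_of_poly_pCons fps_X_power_nth coeff_pCons split: nat.split)
  also have "\<dots> = fps_of_poly ([:- R, 2 * \<delta>:] * [:R, 2 * \<delta> * (D^2 + 2 * D * E - 2), 4 * R * \<delta>^2:])"
    by (simp only: fps_of_poly_mult)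
  also have "[:- R, 2 * \<delta>:] * [:R, 2 * \<delta> * (D^2 + 2 * D * E - 2), 4 * R * \<delta>^2:] =
      [:- (R^2), 2 * \<delta> * R * (3 - D^2 - 2 * D * E), 4 * \<delta>^2 * (D^2 + 2 * D * E - 2 - R^2), 8 * R * \<delta>^3:]"
    by (simp add: algebra_simps power2_eq_square power3_eq_cube)
  finally show ?thesis by (simp add: power2_eq_square)
qed

section \<open>The Boltzmann map as a translation\<close>

locale boltzmann_map = kepler_wall +
  fixes I J :: "ppt2 \<Rightarrow> ppt2"
  assumes I: "extends_wall_exchange D E I" and J: "extends_wall_reflection D E J"
begin

lemma bij_JI: "bij_betw (J \<circ> I) (compact_curve D E) (compact_curve D E)"
  using I J unfolding extends_wall_exchange_def extends_wall_reflection_def curve_automorphism_def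
  by (auto intro: bij_betw_trans)

lemma liftable_JI: "locally_liftable D E (J \<circ> I)"
  using I J unfolding extends_wall_exchange_def extends_wall_reflection_def curve_automorphism_def
  by (intro locally_liftable_comp locally_liftable_if_regular_map) auto

text \<open>\<open>I\<close> changes the sign of \<open>ypsilon\<close>, and \<open>J\<close> takes the third intersection with the line through
  \<open>(0, j R)\<close>. Together they add the point \<open>(0, - j R)\<close> to a point of the cubic curve.\<close>

lemma boltzmann_step:
  assumes gen: "generic x A1 A2"
  obtains x' A1' A2' l where "(J \<circ> I) (embed D (x, A1, A2)) = embed D (x', A1', A2')"
    "ypsilon x A1 A2 = l * xi A1 A2 + - (j * R)"
    "- ypsilon x' A1' A2' = l * xi A1' A2' + - (j * R)"
    "4 * \<delta>^2 * (D^2 + 2 * D * E - 2 - R^2) - l^2 = - (8 * R * \<delta>^3) * (xi A1 A2 + xi A1' A2')"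
    "2 * \<delta> * R * (3 - D^2 - 2 * D * E) - 2 * l * (- (j * R)) = 8 * R * \<delta>^3 * xi A1 A2 * xi A1' A2'"
proof -
  define x' where "x' = - 2 * (A2 + D) * A1 / (1 - A1^2) - x"
  have c: "(x, A1, A2) \<in> level_curve D E" "1 - A1^2 \<noteq> 0" "x'^2 + 1 \<noteq> 0"
    using gen by (simp_all add: generic_def x'_def)
  note ex = wall_exchange_level[OF c(1,2) x'_def]
  define A1' where "A1' = ((x'^2 - 1) * A1 - 2 * x' * A2 + 4 * x' * E) / (x'^2 + 1)"
  define A2' where "A2' = (- 2 * x' * A1 - (x'^2 - 1) * A2 + 4 * x'^2 * E) / (x'^2 + 1)"
  have "I (embed D (x, A1, A2)) = embed D (wall_exchange D (x, A1, A2))"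
    using I c(1,2) unfolding extends_wall_exchange_def by blast
  also have "wall_exchange D (x, A1, A2) = (x', A1, A2)" by (simp add: x'_def)
  finally have "(J \<circ> I) (embed D (x, A1, A2)) = J (embed D (x', A1, A2))" by (simp only: comp_apply)
  also have "\<dots> = embed D (wall_reflection E (x', A1, A2))"
    using J ex(1) c(3) unfolding extends_wall_reflection_def by blast
  also have "wall_reflection E (x', A1, A2) = (x', A1', A2')" by (simp add: A1'_def A2'_def)
  finally have T: "(J \<circ> I) (embed D (x, A1, A2)) = embed D (x', A1', A2')" .
  obtain l where l: "ypsilon x' A1 A2 = j * R - l * xi A1 A2"
    "ypsilon x' A1' A2' = j * R - l * xi A1' A2'"
    "4 * \<delta>^2 * (D^2 + 2 * D * E - 2 - R^2) - l^2 = - (8 * R * \<delta>^3) * (xi A1 A2 + xi A1' A2')"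
    "2 * \<delta> * R * (3 - D^2 - 2 * D * E) - 2 * l * (- (j * R)) = 8 * R * \<delta>^3 * xi A1 A2 * xi A1' A2'"
    using reflection_chord[OF ex(1) c(3) A1'_def A2'_def] .
  have "ypsilon x A1 A2 = l * xi A1 A2 + - (j * R)" using ex(2) l(1) by (simp add: algebra_simps)
  moreover have "- ypsilon x' A1' A2' = l * xi A1' A2' + - (j * R)" using l(2) by simp
  ultimately show ?thesis using that[OF T] l(3,4) by blast
qed

definition generic_point :: "ppt2 \<Rightarrow> bool" where
  "generic_point p \<longleftrightarrow> p \<in> embed D ` {(x, A1, A2). generic x A1 A2}"

lemma closes_iff_generic:
  fixes B :: "complex fps"
  assumes B: "B^2 = fps_of_poly [:- (R^2), 2 * \<delta> * R * (3 - D^2 - 2 * D * E),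
      4 * \<delta>^2 * (D^2 + 2 * D * E - 2 - R^2), 8 * R * \<delta>^3:]" "fps_nth B 0 = - (j * R)"
    and n: "n > 0" and orbit: "\<And>k. k \<le> n \<Longrightarrow> generic_point (((J \<circ> I) ^^ k) p)"
  shows "((J \<circ> I) ^^ n) p = p \<longleftrightarrow>
    (\<exists>p s. degree p \<le> n div 2 \<and> s \<noteq> 0 \<and> degree s < (n - 1) div 2 \<and>
       fps_X ^ n dvd fps_of_poly p + fps_of_poly s * B)"
proof -
  let ?T = "J \<circ> I"
  have "\<exists>x A1 A2. generic x A1 A2 \<and> (?T ^^ k) p = embed D (x, A1, A2)" if "k \<le> n" for k
    using orbit[OF that] unfolding generic_point_def by blast
  then obtain x A1 A2 where gen: "\<And>k. k \<le> n \<Longrightarrow> generic (x k) (A1 k) (A2 k)"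
    and pt: "\<And>k. k \<le> n \<Longrightarrow> (?T ^^ k) p = embed D (x k, A1 k, A2 k)"
    by metis
  define a where "a k = xi (A1 k) (A2 k)" for k
  define b where "b k = ypsilon (x k) (A1 k) (A2 k)" for k
  have "\<exists>l. b k = l * a k + - (j * R) \<and> - b (Suc k) = l * a (Suc k) + - (j * R) \<and>
      4 * \<delta>^2 * (D^2 + 2 * D * E - 2 - R^2) - l^2 = - (8 * R * \<delta>^3) * (a k + a (Suc k)) \<and>
      2 * \<delta> * R * (3 - D^2 - 2 * D * E) - 2 * l * (- (j * R)) = 8 * R * \<delta>^3 * a k * a (Suc k)"
    if k: "k < n" for k
  proof -
    obtain x' A1' A2' l where st: "?T (embed D (x k, A1 k, A2 k)) = embed D (x', A1', A2')"
      "ypsilon (x k) (A1 k) (A2 k) = l * xi (A1 k) (A2 k) + - (j * R)"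
      "- ypsilon x' A1' A2' = l * xi A1' A2' + - (j * R)"
      "4 * \<delta>^2 * (D^2 + 2 * D * E - 2 - R^2) - l^2 = - (8 * R * \<delta>^3) * (xi (A1 k) (A2 k) + xi A1' A2')"
      "2 * \<delta> * R * (3 - D^2 - 2 * D * E) - 2 * l * (- (j * R)) = 8 * R * \<delta>^3 * xi (A1 k) (A2 k) * xi A1' A2'"
      by (rule boltzmann_step[OF gen[OF less_imp_le[OF k]]])
    have "embed D (x (Suc k), A1 (Suc k), A2 (Suc k)) = ?T ((?T ^^ k) p)"
      using pt[of "Suc k"] k by simp
    also have "\<dots> = embed D (x', A1', A2')" using pt[of k] st(1) k by simp
    finally have "(x', A1', A2') = (x (Suc k), A1 (Suc k), A2 (Suc k))"
      using injD[OF inj_embed] by metis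
    then have "x' = x (Suc k)" "A1' = A1 (Suc k)" "A2' = A2 (Suc k)" by simp_all
    with st show ?thesis unfolding a_def b_def by blast
  qed
  then obtain l where l: "\<And>k. k < n \<Longrightarrow> b k = l k * a k + - (j * R)"
    "\<And>k. k < n \<Longrightarrow> - b (Suc k) = l k * a (Suc k) + - (j * R)"
    "\<And>k. k < n \<Longrightarrow> 4 * \<delta>^2 * (D^2 + 2 * D * E - 2 - R^2) - (l k)^2 = - (8 * R * \<delta>^3) * (a k + a (Suc k))"
    "\<And>k. k < n \<Longrightarrow> 2 * \<delta> * R * (3 - D^2 - 2 * D * E) - 2 * l k * (- (j * R)) =
       8 * R * \<delta>^3 * a k * a (Suc k)"
    by metis
  have y0: "(- (j * R))^2 = - (R^2)" using j_square by (simp add: power_mult_distrib)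
  interpret chord_orbit "2 * \<delta> * R * (3 - D^2 - 2 * D * E)" "4 * \<delta>^2 * (D^2 + 2 * D * E - 2 - R^2)"
    "8 * R * \<delta>^3" "- (j * R)" B a b l n
  proof
    show "8 * R * \<delta>^3 \<noteq> 0" using R_nonzero delta0 by simp
    show "a k \<noteq> 0" if "k \<le> n" for k using gen[OF that] by (simp add: generic_def a_def)
  qed (fact B[folded y0] l)+
  have b0: "b 0 \<noteq> 0" using gen[of 0] by (simp add: generic_def b_def)
  have "(?T ^^ n) p = p \<longleftrightarrow> (x n, A1 n, A2 n) = (x 0, A1 0, A2 0)"
    using pt[of n] pt[of 0] injD[OF inj_embed, of D] by (metis funpow_0 le0 le_refl)
  also have "\<dots> \<longleftrightarrow> a n = a 0 \<and> b n = b 0"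
    using coordinates_inject[of "x n" "A1 n" "A2 n" "x 0" "A1 0" "A2 0"] gen[of n] gen[of 0]
    unfolding a_def b_def generic_def by auto
  finally show ?thesis using closes_iff[OF b0 n] by simp
qed

lemma finite_not_generic_orbit:
  "finite {p \<in> compact_curve D E. \<exists>k\<le>n. \<not> generic_point (((J \<circ> I) ^^ k) p)}"
proof -
  let ?C = "compact_curve D E" and ?T = "J \<circ> I"
  have bij: "bij_betw (?T ^^ k) ?C ?C" for k
  proof (induction k)
    case (Suc k)
    have "?T ^^ Suc k = ?T \<circ> ?T ^^ k" by simp
    then show ?case using bij_betw_trans[OF Suc bij_JI] by (simp only:)
  qed (simp add: bij_betw_def)
  have fin: "finite {p \<in> ?C. \<not> generic_point p}"
    using finite_not_generic unfolding generic_point_def by (simp add: set_diff_eq)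
  have "finite ((?T ^^ k) -` {p \<in> ?C. \<not> generic_point p} \<inter> ?C)" for k
    using fin bij_betw_imp_inj_on[OF bij] by (rule finite_vimage_IntI)
  then have "finite (\<Union>k\<le>n. (?T ^^ k) -` {p \<in> ?C. \<not> generic_point p} \<inter> ?C)" by blast
  moreover have "(?T ^^ k) p \<in> ?C" if "p \<in> ?C" for k p
    using bij_betwE[OF bij] that by blast
  ultimately show ?thesis
    by (elim finite_subset[rotated]) (intro subsetI, elim CollectE conjE exE, simp, blast)
qed

text \<open>Every point of the curve is a limit of points with generic orbits: the other points are finitely
  many, the Boltzmann map being a bijection. So one generic orbit yields one implication, and
  continuity the other; the values of \<open>I\<close> and \<open>J\<close> at the other points need not be known.\<close>

theorem periodic_iff:
  fixes B :: "complex fps"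
  assumes B: "B^2 = fps_of_poly [:- (R^2), 2 * \<delta> * R * (3 - D^2 - 2 * D * E),
      4 * \<delta>^2 * (D^2 + 2 * D * E - 2 - R^2), 8 * R * \<delta>^3:]" "fps_nth B 0 = - (j * R)"
    and n: "n > 0"
  shows "(\<forall>p\<in>compact_curve D E. ((J \<circ> I) ^^ n) p = p) \<longleftrightarrow>
    (\<exists>p s. degree p \<le> n div 2 \<and> s \<noteq> 0 \<and> degree s < (n - 1) div 2 \<and>
       fps_X ^ n dvd fps_of_poly p + fps_of_poly s * B)" (is "?L \<longleftrightarrow> ?R")
proof -
  let ?C = "compact_curve D E" and ?T = "J \<circ> I"
  let ?bad = "{p \<in> ?C. \<exists>k\<le>n. \<not> generic_point ((?T ^^ k) p)}"
  have near: "\<exists>zs. zs \<longlonglongrightarrow> z \<and> (\<forall>k. on_cone D E (zs k)) \<and>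
      (\<forall>\<^sub>F k in sequentially. \<forall>i\<le>n. generic_point ((?T ^^ i) (hpt2 (zs k))))"
    if z: "on_cone D E z" for z
  proof -
    obtain zs where zs: "zs \<longlonglongrightarrow> z" "\<And>k. on_cone D E (zs k)" "inj (\<lambda>k. hpt2 (zs k))"
      using curve_point_limit[OF z] by blast
    have "finite ((\<lambda>k. hpt2 (zs k)) -` ?bad)"
      using finite_not_generic_orbit zs(3) by (rule finite_vimageI)
    then have "\<forall>\<^sub>F k in sequentially. k \<notin> (\<lambda>k. hpt2 (zs k)) -` ?bad"
      unfolding cofinite_eq_sequentially[symmetric] eventually_cofinite by (simp add: vimage_def)
    then have "\<forall>\<^sub>F k in sequentially. \<forall>i\<le>n. generic_point ((?T ^^ i) (hpt2 (zs k)))"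
    proof eventually_elim
      case (elim k)
      moreover have "hpt2 (zs k) \<in> ?C" using zs(2) unfolding compact_curve_def by blast
      ultimately show ?case by blast
    qed
    with zs show ?thesis by blast
  qed
  show ?thesis
  proof
    assume L: ?L
    have "on_cone D E ((j, 0, 1), (1, j, 0))"
      using j_square by (simp add: zero_prod_def)
    from near[OF this] obtain zs where zs: "\<And>k. on_cone D E (zs k)"
      "\<forall>\<^sub>F k in sequentially. \<forall>i\<le>n. generic_point ((?T ^^ i) (hpt2 (zs k)))"
      by blast
    from eventually_happens'[OF sequentially_bot zs(2)] obtain k
      where k: "\<forall>i\<le>n. generic_point ((?T ^^ i) (hpt2 (zs k)))" by blast
    have "hpt2 (zs k) \<in> ?C" using zs(1) unfolding compact_curve_def by blast
    with L have "(?T ^^ n) (hpt2 (zs k)) = hpt2 (zs k)" by (rule bspec)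
    moreover have "(?T ^^ n) (hpt2 (zs k)) = hpt2 (zs k) \<longleftrightarrow> ?R"
      by (rule closes_iff_generic[OF B n]) (use k in blast)
    ultimately show ?R by (rule iffD1[rotated])
  next
    assume R: ?R
    show ?L
    proof
      fix p assume "p \<in> ?C"
      then obtain z where z: "on_cone D E z" "p = hpt2 z" unfolding compact_curve_def by blast
      from near[OF z(1)] obtain zs where zs: "zs \<longlonglongrightarrow> z" "\<And>k. on_cone D E (zs k)"
        "\<forall>\<^sub>F k in sequentially. \<forall>i\<le>n. generic_point ((?T ^^ i) (hpt2 (zs k)))" by blast
      have "\<forall>\<^sub>F k in sequentially. (?T ^^ n) (hpt2 (zs k)) = hpt2 (zs k)"
        using zs(3)
      proof eventually_elim
        case (elim k)
        have "(?T ^^ n) (hpt2 (zs k)) = hpt2 (zs k) \<longleftrightarrow> ?R"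
          by (rule closes_iff_generic[OF B n]) (use elim in blast)
        then show ?case using R by (rule iffD2)
      qed
      from liftable_fixes_limit[OF locally_liftable_funpow[OF liftable_JI] z(1) zs(1,2) this]
      show "(?T ^^ n) p = p" unfolding z(2) .
    qed
  qed
qed

lemma periodic_trajectories_iff:
  "(\<forall>S \<in> trajectories D E (J \<circ> I). periodic_trajectory (J \<circ> I) n S) \<longleftrightarrow>
   (\<forall>p\<in>compact_curve D E. ((J \<circ> I) ^^ n) p = p)" (is "?L \<longleftrightarrow> ?R")
proof
  let ?C = "compact_curve D E" and ?T = "J \<circ> I"
  assume L: ?L
  show ?R
  proof
    fix p assume "p \<in> ?C"
    then have "{(?T ^^ k) p | k. True} \<in> trajectories D E ?T" unfolding trajectories_def by blast
    with L have "periodic_trajectory ?T n {(?T ^^ k) p | k. True}" by (rule bspec)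
    moreover have "(?T ^^ 0) p \<in> {(?T ^^ k) p | k. True}" by blast
    ultimately have "(?T ^^ n) ((?T ^^ 0) p) = (?T ^^ 0) p"
      unfolding periodic_trajectory_def by (rule bspec)
    then show "(?T ^^ n) p = p" by (simp only: funpow_0)
  qed
next
  let ?C = "compact_curve D E" and ?T = "J \<circ> I"
  assume R: ?R
  have in_C: "(?T ^^ k) p \<in> ?C" if "p \<in> ?C" for k p
  proof (induction k)
    case (Suc k)
    then have "?T ((?T ^^ k) p) \<in> ?C" by (rule bspec[OF bij_betwE[OF bij_JI]])
    moreover have "(?T ^^ Suc k) p = ?T ((?T ^^ k) p)" by simp
    ultimately show ?case by (simp only:)
  qed (simp add: that)
  show ?L
    unfolding periodic_trajectory_def
  proof (intro ballI)
    fix S q assume "S \<in> trajectories D E ?T" "q \<in> S"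
    then obtain p k where "p \<in> ?C" "q = (?T ^^ k) p" unfolding trajectories_def by blast
    then have "q \<in> ?C" using in_C by (simp only:)
    with R show "(?T ^^ n) q = q" by (rule bspec)
  qed
qed

end

theorem theorem2p1:
  fixes D E R :: complex
    and g :: "complex \<Rightarrow> complex" and B :: "complex fps"
    and I J :: "ppt2 \<Rightarrow> ppt2"
    and m n :: nat
  assumes "D^2 \<noteq> 4" and "1 + 2 * E * D + 4 * E^2 \<noteq> 0" and "D + 2 * E \<noteq> 0"
    and "R^2 = 1 + 2 * D * E + 4 * E^2"
    and "\<forall>\<^sub>F \<xi> in nhds 0. (g \<xi>)^2 =
           (2 * (D + 2 * E) * \<xi> - R) *
           (4 * R * (D + 2 * E)^2 * \<xi>^2 + 2 * (D + 2 * E) * (D^2 + 2 * D * E - 2) * \<xi> + R)"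
    and "g has_fps_expansion B"
    and "extends_wall_exchange D E I" and "extends_wall_reflection D E J"
  shows "(n = 2 * m \<and> n \<ge> 4 \<longrightarrow>
            ((\<forall>S \<in> trajectories D E (J \<circ> I). periodic_trajectory (J \<circ> I) n S) \<longleftrightarrow>
             Determinant.det (Matrix.mat (m - 1) (m - 1) (\<lambda>(p, q). fps_nth B (p + q + 3))) = 0)) \<and>
         (n = 2 * m + 1 \<and> n \<ge> 3 \<longrightarrow>
            ((\<forall>S \<in> trajectories D E (J \<circ> I). periodic_trajectory (J \<circ> I) n S) \<longleftrightarrow>
             Determinant.det (Matrix.mat m m (\<lambda>(p, q). fps_nth B (p + q + 2))) = 0))"
proof -
  have R: "R \<noteq> 0" using assms(2,4) by (auto simp: mult_ac)
  have wall: "kepler_wall D E R \<i>"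
    using assms(3,4) R by unfold_locales simp_all
  note B = kepler_wall.sqrt_expansion[OF wall assms(5,6)]
  \<comment> \<open>With this choice, the branch of the square root expanded in \<open>B\<close> is the one through \<open>(0, - j R)\<close>, the
      point added by the Boltzmann map.\<close>
  define j where "j = - fps_nth B 0 / R"
  have B0: "fps_nth B 0 = - (j * R)" using R by (simp add: j_def)
  have "(fps_nth B 0)^2 = - (R^2)"
    using arg_cong[OF B, of "\<lambda>F. fps_nth F 0"] by (simp only: fps_nth_power_0 fps_of_poly_nth coeff_pCons_0)
  then have j: "j^2 = - 1" using R by (simp add: j_def power_divide)
  interpret boltzmann_map D E R j I J
    using assms(3,4,7,8) R j by unfold_locales
  have B': "B^2 = fps_of_poly [:- (R^2), 2 * \<delta> * R * (3 - D^2 - 2 * D * E),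
      4 * \<delta>^2 * (D^2 + 2 * D * E - 2 - R^2), 8 * R * \<delta>^3:]"
    by (rule sqrt_expansion[OF assms(5,6)])
  \<comment> \<open>The parity of \<open>n\<close> enters only through the pole orders \<open>2 i\<close> and \<open>2 i + 3\<close> of the functions \<open>\<xi>^i\<close> and
      \<open>\<xi>^i y\<close>, which limit the degrees to \<open>n div 2\<close> and less than \<open>(n - 1) div 2\<close>.\<close>
  have main: "(\<forall>S \<in> trajectories D E (J \<circ> I). periodic_trajectory (J \<circ> I) n S) \<longleftrightarrow>
      Determinant.det (Matrix.mat N N (\<lambda>(p, q). fps_nth B (p + q + r))) = 0"
    if "n > 0" "N = (n - 1) div 2" "n div 2 + 2 = N + r" for N r
  proof -
    have n: "n div 2 + N + 1 = n" using that(1,2) by linarith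
    show ?thesis
      unfolding periodic_trajectories_iff periodic_iff[OF B' B0 that(1)] that(2)[symmetric]
      by (rule hankel_det_eq_0_iff[OF that(3), of B, unfolded n, symmetric])
  qed
  show ?thesis
  proof (intro conjI impI)
    assume "n = 2 * m \<and> n \<ge> 4"
    then show "(\<forall>S \<in> trajectories D E (J \<circ> I). periodic_trajectory (J \<circ> I) n S) \<longleftrightarrow>
        Determinant.det (Matrix.mat (m - 1) (m - 1) (\<lambda>(p, q). fps_nth B (p + q + 3))) = 0"
      by (intro main) auto
  next
    assume "n = 2 * m + 1 \<and> n \<ge> 3"
    then show "(\<forall>S \<in> trajectories D E (J \<circ> I). periodic_trajectory (J \<circ> I) n S) \<longleftrightarrow>
        Determinant.det (Matrix.mat m m (\<lambda>(p, q). fps_nth B (p + q + 2))) = 0"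
      by (intro main) auto
  qed
qed

end
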